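(* Let $X$ be a complex Banach space and let $T\in\mathcal{B}(X)$. Then $$\sigma_{gD}(T)=\sigma_{gK}(T)\cup\bigl(S(T)\cup S(T^* )\bigr).$$
   Context: $\mathcal{B}(X)$ is the algebra of bounded linear operators on the complex Banach space $X$; $T^*$ is the adjoint of $T$ (acting on the dual $X^*$); $N(T)$, $R(T)$ are the null space and range, and $R^{\infty}(T)=\bigcap_{n\ge 0}R(T^n)$. $T$ is semi-regular (Kato) if $R(T)$ is closed and $N(T)\subseteq R^\infty(T)$. $T$ is Pseudo-Fredholm (admits a generalized Kato decomposition) if there are $T$-invariant closed subspaces $M,N$ with $X=M\oplus N$, $T|_M$ semi-regular and $T|_N$ quasinilpotent (here $M=\{0\}$ or $N=\{0\}$ is allowed). $\sigma_{gK}(T)=\{\lambda\in\mathbb{C}: T-\lambda I \text{ is not Pseudo-Fredholm}\}$. $T$ is generalized Drazin invertible if $0$ is not an accumulation point of the spectrum $\sigma(T)$. $\sigma_{gD}(T)=\{\lambda\in\mathbb{C}: T-\lambda I\text{ is not generalized Drazin invertible}\}$. $T$ has the single-valued extension property (SVEP) at $\lambda_0\in\mathbb{C}$ if for every open neighbourhood $U\subseteq\mathbb{C}$ of $\lambda_0$, the only analytic function $f:U\to X$ with $(T-zI)f(z)=0$ for all $z\in U$ is $f\equiv 0$. $S(T)$ is the set of $\lambda\in\mathbb{C}$ at which $T$ does not have the SVEP; $S(T^* )$ is defined likewise for $T^*$.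
   Formalization: In the definition of the SVEP at a point, the open neighbourhoods U are taken to be connected; with arbitrary open U the claimed equality would fail, e.g. for the backward shift on l^2, where S(T) would be all of C. *)

theory Defs
  imports "HOL-Analysis.Analysis"
begin

section \<open>Complex normed and Banach spaces\<close>

class complex_normed_vector = real_normed_vector +
  fixes scaleC :: "complex \<Rightarrow> 'a \<Rightarrow> 'a"  (infixr "*\<^sub>C" 75)
  assumes scaleC_add_right: "a *\<^sub>C (x + y) = a *\<^sub>C x + a *\<^sub>C y"
    and scaleC_add_left: "(a + b) *\<^sub>C x = a *\<^sub>C x + b *\<^sub>C x"
    and scaleC_scaleC: "a *\<^sub>C b *\<^sub>C x = (a * b) *\<^sub>C x"
    and scaleC_of_real: "complex_of_real r *\<^sub>C x = r *\<^sub>R x"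
    and norm_scaleC: "norm (a *\<^sub>C x) = cmod a * norm x"

class complex_banach = complex_normed_vector + banach

instantiation complex :: complex_normed_vector
begin

definition scaleC_complex :: "complex \<Rightarrow> complex \<Rightarrow> complex"
  where "scaleC_complex a x = a * x"

instance
  by standard (auto simp: scaleC_complex_def algebra_simps norm_mult scaleR_conv_of_real)

end

instance complex :: complex_banach ..

lemma bounded_linear_scaleC_right: "bounded_linear (\<lambda>x::'a::complex_normed_vector. a *\<^sub>C x)"
proof (rule bounded_linear_intro[where K = "cmod a"])
  fix r and x :: 'a
  show "a *\<^sub>C r *\<^sub>R x = r *\<^sub>R a *\<^sub>C x"
    by (simp flip: scaleC_of_real add: scaleC_scaleC mult.commute)
qed (auto simp: scaleC_add_right norm_scaleC mult.commute)

lemma scaleC_zero_right [simp]: "a *\<^sub>C 0 = (0 :: 'a::complex_normed_vector)"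
  using norm_scaleC[of a "0::'a"] by simp

lemma scaleC_diff_right: "a *\<^sub>C (x - y) = a *\<^sub>C x - a *\<^sub>C (y :: 'a::complex_normed_vector)"
  by (rule linear_diff[OF bounded_linear.linear[OF bounded_linear_scaleC_right]])

lemma scaleC_minus_right: "a *\<^sub>C (- x) = - (a *\<^sub>C (x :: 'a::complex_normed_vector))"
  by (rule linear_neg[OF bounded_linear.linear[OF bounded_linear_scaleC_right]])

definition closed_csubspace :: "'a::complex_normed_vector set \<Rightarrow> bool"
  where "closed_csubspace M \<longleftrightarrow>
    closed M \<and> 0 \<in> M \<and> (\<forall>x\<in>M. \<forall>y\<in>M. x + y \<in> M) \<and> (\<forall>c. \<forall>x\<in>M. c *\<^sub>C x \<in> M)"

section \<open>Bounded complex-linear operators\<close>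

typedef (overloaded) ('a, 'b) cblinfun =
  "{f :: 'a::complex_normed_vector \<Rightarrow>\<^sub>L 'b::complex_normed_vector. \<forall>c x. f (c *\<^sub>C x) = c *\<^sub>C f x}"
  morphisms blinfun_of Abs_cblinfun
  by (rule exI[of _ 0]) simp

setup_lifting type_definition_cblinfun

type_notation cblinfun  ("(_ \<Rightarrow>\<^sub>C\<^sub>L /_)" [22, 21] 21)

lift_definition capply :: "('a::complex_normed_vector \<Rightarrow>\<^sub>C\<^sub>L 'b::complex_normed_vector) \<Rightarrow> 'a \<Rightarrow> 'b"
  is blinfun_apply .

lemma capply_scaleC: "capply f (c *\<^sub>C x) = c *\<^sub>C capply f x"
  by transfer simp

definition blinfun_scaleC :: "complex \<Rightarrow> ('a::real_normed_vector \<Rightarrow>\<^sub>L 'b::complex_normed_vector) \<Rightarrow> 'a \<Rightarrow>\<^sub>L 'b"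
  where "blinfun_scaleC c f = Blinfun (\<lambda>x. c *\<^sub>C blinfun_apply f x)"

lemma blinfun_scaleC_apply: "blinfun_apply (blinfun_scaleC c f) x = c *\<^sub>C blinfun_apply f x"
  by (simp add: blinfun_scaleC_def bounded_linear_Blinfun_apply
      bounded_linear_compose[OF bounded_linear_scaleC_right blinfun.bounded_linear_right])

lemma norm_blinfun_scaleC_le: "norm (blinfun_scaleC c f) \<le> cmod c * norm f"
  by (rule norm_blinfun_bound)
    (auto simp: blinfun_scaleC_apply norm_scaleC mult.assoc intro!: mult_left_mono norm_blinfun)

instantiation cblinfun :: (complex_normed_vector, complex_normed_vector) complex_normed_vector
begin

lift_definition zero_cblinfun :: "'a \<Rightarrow>\<^sub>C\<^sub>L 'b" is 0
  by simp

lift_definition plus_cblinfun :: "('a \<Rightarrow>\<^sub>C\<^sub>L 'b) \<Rightarrow> ('a \<Rightarrow>\<^sub>C\<^sub>L 'b) \<Rightarrow> 'a \<Rightarrow>\<^sub>C\<^sub>L 'b" is "(+)"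
  by (simp add: plus_blinfun.rep_eq scaleC_add_right)

lift_definition minus_cblinfun :: "('a \<Rightarrow>\<^sub>C\<^sub>L 'b) \<Rightarrow> ('a \<Rightarrow>\<^sub>C\<^sub>L 'b) \<Rightarrow> 'a \<Rightarrow>\<^sub>C\<^sub>L 'b" is "(-)"
  by (simp add: minus_blinfun.rep_eq scaleC_diff_right)

lift_definition uminus_cblinfun :: "('a \<Rightarrow>\<^sub>C\<^sub>L 'b) \<Rightarrow> 'a \<Rightarrow>\<^sub>C\<^sub>L 'b" is uminus
  by (simp add: uminus_blinfun.rep_eq scaleC_minus_right)

lift_definition scaleR_cblinfun :: "real \<Rightarrow> ('a \<Rightarrow>\<^sub>C\<^sub>L 'b) \<Rightarrow> 'a \<Rightarrow>\<^sub>C\<^sub>L 'b" is scaleR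
  by (simp add: scaleR_blinfun.rep_eq scaleC_scaleC mult.commute flip: scaleC_of_real)

lift_definition scaleC_cblinfun :: "complex \<Rightarrow> ('a \<Rightarrow>\<^sub>C\<^sub>L 'b) \<Rightarrow> 'a \<Rightarrow>\<^sub>C\<^sub>L 'b"
  is blinfun_scaleC
  by (simp add: blinfun_scaleC_apply scaleC_scaleC mult.commute)

lift_definition norm_cblinfun :: "('a \<Rightarrow>\<^sub>C\<^sub>L 'b) \<Rightarrow> real" is norm .

definition dist_cblinfun :: "('a \<Rightarrow>\<^sub>C\<^sub>L 'b) \<Rightarrow> ('a \<Rightarrow>\<^sub>C\<^sub>L 'b) \<Rightarrow> real"
  where "dist_cblinfun f g = norm (f - g)"

definition uniformity_cblinfun_def:
  "(uniformity :: (('a \<Rightarrow>\<^sub>C\<^sub>L 'b) \<times> ('a \<Rightarrow>\<^sub>C\<^sub>L 'b)) filter) =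
    (INF e\<in>{0 <..}. principal {(f, g). dist f g < e})"

definition open_cblinfun :: "('a \<Rightarrow>\<^sub>C\<^sub>L 'b) set \<Rightarrow> bool"
  where "open_cblinfun S =
    (\<forall>f\<in>S. \<forall>\<^sub>F (f', g) in uniformity. f' = f \<longrightarrow> g \<in> S)"

definition sgn_cblinfun :: "('a \<Rightarrow>\<^sub>C\<^sub>L 'b) \<Rightarrow> 'a \<Rightarrow>\<^sub>C\<^sub>L 'b"
  where "sgn_cblinfun f = scaleR (inverse (norm f)) f"

instance
proof
  fix f g h :: "'a \<Rightarrow>\<^sub>C\<^sub>L 'b" and a b :: complex and r s :: real
  show "f + g + h = f + (g + h)" "f + g = g + f" "0 + f = f" "- f + f = 0" "f - g = f + - g"
    by (transfer; simp)+
  show "r *\<^sub>R (f + g) = r *\<^sub>R f + r *\<^sub>R g" "(r + s) *\<^sub>R f = r *\<^sub>R f + s *\<^sub>R f"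
    "r *\<^sub>R s *\<^sub>R f = (r * s) *\<^sub>R f" "1 *\<^sub>R f = f"
    by (transfer; simp add: algebra_simps)+
  show "dist f g = norm (f - g)" "sgn f = inverse (norm f) *\<^sub>R f"
    by (simp_all add: dist_cblinfun_def sgn_cblinfun_def)
  show "(uniformity :: (('a \<Rightarrow>\<^sub>C\<^sub>L 'b) \<times> ('a \<Rightarrow>\<^sub>C\<^sub>L 'b)) filter) =
      (INF e\<in>{0 <..}. principal {(f, g). dist f g < e})"
    by (simp add: uniformity_cblinfun_def)
  show "open U = (\<forall>f\<in>U. \<forall>\<^sub>F (f', g) in uniformity. f' = f \<longrightarrow> g \<in> U)" for U :: "('a \<Rightarrow>\<^sub>C\<^sub>L 'b) set"
    by (simp add: open_cblinfun_def)
  show "(norm f = 0) = (f = 0)" by transfer simp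
  show "norm (f + g) \<le> norm f + norm g" by transfer (rule norm_triangle_ineq)
  show "norm (r *\<^sub>R f) = \<bar>r\<bar> * norm f" by transfer simp
  show "a *\<^sub>C (f + g) = a *\<^sub>C f + a *\<^sub>C g"
    by (transfer, rule blinfun_eqI)
      (simp only: blinfun_scaleC_apply plus_blinfun.rep_eq scaleC_add_right)
  show "(a + b) *\<^sub>C f = a *\<^sub>C f + b *\<^sub>C f"
    by (transfer, rule blinfun_eqI)
      (simp only: blinfun_scaleC_apply plus_blinfun.rep_eq scaleC_add_left)
  show "a *\<^sub>C b *\<^sub>C f = (a * b) *\<^sub>C f"
    by (transfer, rule blinfun_eqI) (simp only: blinfun_scaleC_apply scaleC_scaleC)
  show "complex_of_real r *\<^sub>C f = r *\<^sub>R f"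
    by (transfer, rule blinfun_eqI)
      (simp only: blinfun_scaleC_apply scaleR_blinfun.rep_eq scaleC_of_real)
  show "norm (a *\<^sub>C f) = cmod a * norm f"
  proof (transfer, rule antisym)
    fix a :: complex and f :: "'a \<Rightarrow>\<^sub>L 'b"
    show "norm (blinfun_scaleC a f) \<le> cmod a * norm f" by (rule norm_blinfun_scaleC_le)
    show "cmod a * norm f \<le> norm (blinfun_scaleC a f)"
    proof (cases "a = 0")
      case False
      have "blinfun_scaleC (inverse a) (blinfun_scaleC a f) = f"
        using False scaleC_of_real[of 1]
        by (intro blinfun_eqI) (simp add: blinfun_scaleC_apply scaleC_scaleC)
      then have "norm f \<le> cmod (inverse a) * norm (blinfun_scaleC a f)"
        by (metis norm_blinfun_scaleC_le)
      then show ?thesis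
        using False by (simp add: norm_divide field_simps)
    qed simp
  qed
qed

end

lemma capply_plus: "capply (f + g) x = capply f x + capply g x"
  by transfer (simp add: plus_blinfun.rep_eq)

lemma capply_minus: "capply (f - g) x = capply f x - capply g x"
  by transfer (simp add: minus_blinfun.rep_eq)

lemma capply_cblinfun_scaleC: "capply (c *\<^sub>C f) x = c *\<^sub>C capply f x"
  by transfer (simp add: blinfun_scaleC_apply)

lemma bounded_linear_capply: "bounded_linear (capply f)"
  by transfer (rule blinfun.bounded_linear_right)

lemma norm_cblinfun_eq_onorm: "norm f = onorm (capply f)"
  by transfer (rule norm_blinfun.rep_eq)

lemma cblinfun_eqI: "(\<And>x. capply f x = capply g x) \<Longrightarrow> f = g"
  by transfer (rule blinfun_eqI)

instance cblinfun :: (complex_normed_vector, complex_banach) complex_banach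
proof
  fix X :: "nat \<Rightarrow> 'a \<Rightarrow>\<^sub>C\<^sub>L 'b"
  have dist_eq: "dist f g = dist (blinfun_of f) (blinfun_of g)" for f g :: "'a \<Rightarrow>\<^sub>C\<^sub>L 'b"
    by (simp add: dist_cblinfun_def norm_cblinfun.rep_eq minus_cblinfun.rep_eq dist_norm)
  assume "Cauchy X"
  then have "Cauchy (\<lambda>n. blinfun_of (X n))"
    by (simp add: Cauchy_def dist_eq)
  then obtain L where L: "(\<lambda>n. blinfun_of (X n)) \<longlonglongrightarrow> L"
    using Cauchy_convergent convergent_def by blast
  have "blinfun_apply L (c *\<^sub>C x) = c *\<^sub>C blinfun_apply L x" for c x
  proof (rule LIMSEQ_unique)
    have lim: "(\<lambda>n. blinfun_apply (blinfun_of (X n)) y) \<longlonglongrightarrow> blinfun_apply L y" for y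
      using L by (intro blinfun.tendsto) auto
    show "(\<lambda>n. blinfun_apply (blinfun_of (X n)) (c *\<^sub>C x)) \<longlonglongrightarrow> blinfun_apply L (c *\<^sub>C x)"
      by (rule lim)
    show "(\<lambda>n. blinfun_apply (blinfun_of (X n)) (c *\<^sub>C x)) \<longlonglongrightarrow> c *\<^sub>C blinfun_apply L x"
      using bounded_linear.tendsto[OF bounded_linear_scaleC_right lim, of c x]
      by (simp flip: capply.rep_eq add: capply_scaleC)
  qed
  then have "blinfun_of (Abs_cblinfun L) = L"
    by (simp add: Abs_cblinfun_inverse)
  then have "X \<longlonglongrightarrow> Abs_cblinfun L"
    using L by (simp add: lim_sequentially dist_eq)
  then show "convergent X"
    by (auto simp: convergent_def)
qed

lift_definition id_cblinfun :: "'a::complex_normed_vector \<Rightarrow>\<^sub>C\<^sub>L 'a" is id_blinfun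
  by simp

lift_definition cblinfun_compose ::
  "('b::complex_normed_vector \<Rightarrow>\<^sub>C\<^sub>L 'c::complex_normed_vector) \<Rightarrow>
    ('a::complex_normed_vector \<Rightarrow>\<^sub>C\<^sub>L 'b) \<Rightarrow> 'a \<Rightarrow>\<^sub>C\<^sub>L 'c"  (infixl "o\<^sub>C\<^sub>L" 67)
  is "(o\<^sub>L)"
  by simp

lemma capply_id: "capply id_cblinfun x = x"
  by transfer simp

lemma capply_compose: "capply (f o\<^sub>C\<^sub>L g) x = capply f (capply g x)"
  by transfer simp

type_synonym 'a cdual = "'a \<Rightarrow>\<^sub>C\<^sub>L complex"

text \<open>The operator with a given underlying map; meaningful only for bounded complex-linear maps.\<close>

definition make_cblinfun ::
  "('a::complex_normed_vector \<Rightarrow> 'b::complex_normed_vector) \<Rightarrow> 'a \<Rightarrow>\<^sub>C\<^sub>L 'b"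
  where "make_cblinfun f = Abs_cblinfun (Blinfun f)"

lemma capply_make_cblinfun:
  assumes "bounded_linear f" "\<And>c x. f (c *\<^sub>C x) = c *\<^sub>C f x"
  shows "capply (make_cblinfun f) x = f x"
  using assms
  by (simp add: make_cblinfun_def capply.rep_eq Abs_cblinfun_inverse bounded_linear_Blinfun_apply)

text \<open>The Banach space adjoint; it is complex-linear, not conjugate-linear, in the operator.\<close>

definition cadjoint ::
  "('a::complex_normed_vector \<Rightarrow>\<^sub>C\<^sub>L 'b::complex_normed_vector) \<Rightarrow> 'b cdual \<Rightarrow>\<^sub>C\<^sub>L 'a cdual"
  where "cadjoint T = make_cblinfun (\<lambda>\<phi>. \<phi> o\<^sub>C\<^sub>L T)"

lemma capply_cadjoint:
  fixes T :: "'a::complex_normed_vector \<Rightarrow>\<^sub>C\<^sub>L 'b::complex_normed_vector"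
  shows "capply (cadjoint T) \<phi> = \<phi> o\<^sub>C\<^sub>L T"
proof -
  have "bounded_linear (\<lambda>\<phi>::'b cdual. \<phi> o\<^sub>C\<^sub>L T)"
  proof (rule bounded_linear_intro[where K = "norm T"])
    show "norm (\<phi> o\<^sub>C\<^sub>L T) \<le> norm \<phi> * norm T" for \<phi> :: "'b cdual"
      by transfer (rule norm_blinfun_compose)
  qed (auto intro!: cblinfun_eqI
      simp: capply_compose capply_plus capply_cblinfun_scaleC simp flip: scaleC_of_real)
  then show ?thesis
    unfolding cadjoint_def
    by (rule capply_make_cblinfun)
      (auto intro!: cblinfun_eqI simp: capply_compose capply_cblinfun_scaleC)
qed

section \<open>Spectral notions\<close>

abbreviation shift :: "('a::complex_normed_vector \<Rightarrow>\<^sub>C\<^sub>L 'a) \<Rightarrow> complex \<Rightarrow> 'a \<Rightarrow>\<^sub>C\<^sub>L 'a"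
  where "shift T l \<equiv> T - l *\<^sub>C id_cblinfun"

definition cinvertible :: "('a::complex_normed_vector \<Rightarrow>\<^sub>C\<^sub>L 'a) \<Rightarrow> bool"
  where "cinvertible T \<longleftrightarrow> (\<exists>S. S o\<^sub>C\<^sub>L T = id_cblinfun \<and> T o\<^sub>C\<^sub>L S = id_cblinfun)"

definition spectrum :: "('a::complex_normed_vector \<Rightarrow>\<^sub>C\<^sub>L 'a) \<Rightarrow> complex set"
  where "spectrum T = {l. \<not> cinvertible (shift T l)}"

text \<open>Spectrum of the restriction of \<open>T\<close> to a closed \<open>T\<close>-invariant subspace \<open>M\<close>, as an
  operator on \<open>M\<close>. Only the values of \<open>S\<close> on \<open>M\<close> matter; being inverse to a linear map, \<open>S\<close> is
  automatically linear on \<open>M\<close>.\<close>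

definition spectrum_on :: "'a::complex_normed_vector set \<Rightarrow> ('a \<Rightarrow>\<^sub>C\<^sub>L 'a) \<Rightarrow> complex set"
  where "spectrum_on M T =
    {l. \<not> (\<exists>S K. \<forall>x\<in>M. S x \<in> M \<and> norm (S x) \<le> K * norm x \<and>
          S (capply (shift T l) x) = x \<and> capply (shift T l) (S x) = x)}"

lemma spectrum_on_UNIV: "spectrum_on UNIV T = spectrum T"
proof -
  have "(\<exists>S K. \<forall>x\<in>UNIV. S x \<in> UNIV \<and> norm (S x) \<le> K * norm x \<and>
      S (capply A x) = x \<and> capply A (S x) = x) \<longleftrightarrow> cinvertible A" (is "?L \<longleftrightarrow> _")
    for A :: "'a \<Rightarrow>\<^sub>C\<^sub>L 'a"
  proof
    assume ?L
    then obtain S K where S: "\<And>x. norm (S x) \<le> K * norm x" "\<And>x. S (capply A x) = x"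
      "\<And>x. capply A (S x) = x"
      by auto
    have add: "S (x + y) = S x + S y" for x y
    proof -
      have "S (x + y) = S (capply A (S x + S y))"
        by (simp only: linear_simps(1)[OF bounded_linear_capply] S(3))
      then show ?thesis
        by (simp only: S(2))
    qed
    have scaleC: "S (c *\<^sub>C x) = c *\<^sub>C S x" for c x
    proof -
      have "S (c *\<^sub>C x) = S (capply A (c *\<^sub>C S x))"
        by (simp only: capply_scaleC S(3))
      then show ?thesis
        by (simp only: S(2))
    qed
    have "bounded_linear S"
      by (rule bounded_linear_intro[where K = K])
        (use S(1) add scaleC in \<open>simp_all add: mult.commute[of _ K] flip: scaleC_of_real\<close>)
    then have "capply (make_cblinfun S) x = S x" for x
      using scaleC by (rule capply_make_cblinfun)
    then have "make_cblinfun S o\<^sub>C\<^sub>L A = id_cblinfun" "A o\<^sub>C\<^sub>L make_cblinfun S = id_cblinfun"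
      by (auto intro!: cblinfun_eqI simp: capply_compose capply_id S)
    then show "cinvertible A"
      by (auto simp: cinvertible_def)
  next
    assume "cinvertible A"
    then obtain S where "S o\<^sub>C\<^sub>L A = id_cblinfun" "A o\<^sub>C\<^sub>L S = id_cblinfun"
      by (auto simp: cinvertible_def)
    then have "capply S (capply A x) = x" "capply A (capply S x) = x" for x
      by (simp_all only: capply_id flip: capply_compose)
    moreover have "norm (capply S x) \<le> onorm (capply S) * norm x" for x
      by (rule onorm[OF bounded_linear_capply])
    ultimately show ?L
      by blast
  qed
  then show ?thesis
    by (simp only: spectrum_on_def spectrum_def)
qed

definition generalized_Drazin_invertible :: "('a::complex_normed_vector \<Rightarrow>\<^sub>C\<^sub>L 'a) \<Rightarrow> bool"
  where "generalized_Drazin_invertible T \<longleftrightarrow> \<not> 0 islimpt spectrum T"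

definition sigma_gD :: "('a::complex_normed_vector \<Rightarrow>\<^sub>C\<^sub>L 'a) \<Rightarrow> complex set"
  where "sigma_gD T = {l. \<not> generalized_Drazin_invertible (shift T l)}"

text \<open>The next two predicates concern the restriction of \<open>T\<close> to a closed \<open>T\<close>-invariant subspace
  \<open>M\<close>. As \<open>M\<close> is closed, being closed in \<open>M\<close> is the same as being closed in the whole space.\<close>

definition semi_regular_on :: "'a::complex_normed_vector set \<Rightarrow> ('a \<Rightarrow>\<^sub>C\<^sub>L 'a) \<Rightarrow> bool"
  where "semi_regular_on M T \<longleftrightarrow>
    closed (capply T ` M) \<and> {x\<in>M. capply T x = 0} \<subseteq> (\<Inter>n. (capply T ^^ n) ` M)"

text \<open>The inclusion (instead of equality with \<open>{0}\<close>) only serves to admit the zero subspace,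
  on which the spectrum is empty.\<close>

definition quasinilpotent_on :: "'a::complex_normed_vector set \<Rightarrow> ('a \<Rightarrow>\<^sub>C\<^sub>L 'a) \<Rightarrow> bool"
  where "quasinilpotent_on M T \<longleftrightarrow> spectrum_on M T \<subseteq> {0}"

definition pseudo_Fredholm :: "('a::complex_normed_vector \<Rightarrow>\<^sub>C\<^sub>L 'a) \<Rightarrow> bool"
  where "pseudo_Fredholm T \<longleftrightarrow>
    (\<exists>M N. closed_csubspace M \<and> closed_csubspace N \<and>
      capply T ` M \<subseteq> M \<and> capply T ` N \<subseteq> N \<and>
      M \<inter> N = {0} \<and> {x + y |x y. x \<in> M \<and> y \<in> N} = UNIV \<and>
      semi_regular_on M T \<and> quasinilpotent_on N T)"

definition sigma_gK :: "('a::complex_normed_vector \<Rightarrow>\<^sub>C\<^sub>L 'a) \<Rightarrow> complex set"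
  where "sigma_gK T = {l. \<not> pseudo_Fredholm (shift T l)}"

section \<open>The single-valued extension property\<close>

definition vanalytic_on :: "(complex \<Rightarrow> 'a::complex_normed_vector) \<Rightarrow> complex set \<Rightarrow> bool"
    (infix "vanalytic'_on" 50)
  where "f vanalytic_on U \<longleftrightarrow> (\<forall>z\<in>U. \<exists>d. (f has_derivative (\<lambda>h. h *\<^sub>C d)) (at z))"

text \<open>The neighbourhoods \<open>U\<close> have to be taken connected: on disconnected sets, an \<open>f\<close> that is
  nonzero only on components not containing \<open>l\<close> would turn the property at \<open>l\<close> into the
  property at all points of the plane.\<close>

definition SVEP_at :: "('a::complex_normed_vector \<Rightarrow>\<^sub>C\<^sub>L 'a) \<Rightarrow> complex \<Rightarrow> bool"
  where "SVEP_at T l \<longleftrightarrow>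
    (\<forall>U f. open U \<and> connected U \<and> l \<in> U \<and> f vanalytic_on U \<and>
      (\<forall>z\<in>U. capply (shift T z) (f z) = 0) \<longrightarrow> (\<forall>z\<in>U. f z = 0))"

definition no_SVEP_set :: "('a::complex_normed_vector \<Rightarrow>\<^sub>C\<^sub>L 'a) \<Rightarrow> complex set"
  where "no_SVEP_set T = {l. \<not> SVEP_at T l}"

end

theory Submission
  imports Defs "HOL-Complex_Analysis.Conformal_Mappings"
begin

text \<open>Fix \<open>l\<close> and put \<open>A = T - l I\<close>. The claim is that \<open>0\<close> is not an accumulation point of the spectrum
of \<open>A\<close> if and only if \<open>A\<close> is pseudo-Fredholm and both \<open>T\<close> and its adjoint have the single-valued
extension property (SVEP) at \<open>l\<close>.

Suppose that \<open>A - z I\<close> is invertible for all small \<open>z \<noteq> 0\<close>. Then an analytic solution of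
\<open>(T - z I) f(z) = 0\<close> vanishes on a punctured disc around \<open>l\<close>, hence everywhere on a connected domain,
by the scalar identity theorem applied to the functions \<open>\<phi> \<circ> f\<close>
(\<open>SVEP_if_punctured_injective\<close>); the adjoint of an invertible operator being injective, this
applies to the adjoint as well. The generalized Kato decomposition is given by the spectral
idempotent \<open>q\<close> of the set \<open>{0}\<close> (\<open>isolated_spectral_idempotent\<close>): \<open>A\<close> is quasinilpotent on the
range of \<open>q\<close> and bijective on its kernel. The usual contour integral for \<open>q\<close> is replaced by its
Riemann sums. With \<open>b = A/r\<close> for a small radius \<open>r\<close>, the mean of the resolvents
\<open>(1 - \<omega> b)\<^sup>-\<^sup>1\<close> over the roots of unity \<open>\<omega>\<close> of order \<open>2^k\<close> is \<open>x\<^sub>k = (1 - b^(2^k))\<^sup>-\<^sup>1\<close>. More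
generally, the functions \<open>g\<^sub>k(t) = (1 - cis t b^(2^k))\<^sup>-\<^sup>1\<close> satisfy
\<open>g\<^bsub>k+1\<^esub>(t) = (g\<^sub>k(t/2) + g\<^sub>k(t/2 + \<pi>))/2 = g\<^sub>k(t/2) g\<^sub>k(t/2 + \<pi>)\<close>.
By the first equation the Lipschitz constant of \<open>g\<^sub>k\<close> is halved in each step, so that the
\<open>x\<^sub>k = g\<^sub>k(0)\<close> converge. Together the equations give \<open>x\<^sub>k (2 x\<^bsub>k+1\<^esub> - x\<^sub>k) = x\<^bsub>k+1\<^esub>\<close>, and in the limit
\<open>q q = q\<close>.

Conversely, let \<open>X = M \<oplus> N\<close> be a generalized Kato decomposition of \<open>A\<close>. A sequence with
\<open>A x\<^sub>0 = 0 \<noteq> x\<^sub>0\<close>, \<open>A x\<^bsub>n+1\<^esub> = x\<^sub>n\<close> and \<open>\<parallel>x\<^bsub>n+1\<^esub>\<parallel> \<le> C \<parallel>x\<^sub>n\<parallel>\<close> refutes the SVEP by means of the power series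
\<open>\<Sum>\<^sub>n (z - l)^n x\<^sub>n\<close> (\<open>no_SVEP_if_backward_orbit\<close>). If \<open>A\<close> is not injective on \<open>M\<close>, such a sequence exists in
the intersection of the ranges of the powers of \<open>A\<close> on \<open>M\<close>, because \<open>A\<close> maps this intersection onto
itself and, by the open mapping theorem, preimages can be chosen of comparable norm. If \<open>A\<close> is
injective but not surjective on \<open>M\<close>, such a sequence exists in the dual space: a nonzero functional
annihilating \<open>A M\<close> and \<open>N\<close> is in the kernel of the adjoint, and a functional \<open>\<phi>\<close> annihilating \<open>N\<close> is
the image under the adjoint of a Hahn-Banach extension of \<open>\<phi> \<circ> A\<^sup>-\<^sup>1\<close> from \<open>A M\<close>, composed with the
projection onto \<open>M\<close> along \<open>N\<close>. So both SVEP conditions make \<open>A\<close> bijective on \<open>M\<close>. Then \<open>A - z I\<close> is bijective on \<open>M\<close> for small \<open>z\<close>, and on \<open>N\<close> for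
all \<open>z \<noteq> 0\<close>.\<close>

section \<open>The Hahn-Banach theorem\<close>

text \<open>Encoding a linear functional by its graph, a subspace of \<open>X \<times> \<real>\<close>, makes extension the same as
inclusion. Domination by \<open>K \<parallel>x\<parallel>\<close> already forces such a subspace to be a graph: if it contains
\<open>(0, a)\<close>, it also contains \<open>(0, -a)\<close>, so \<open>a \<le> 0\<close> and \<open>-a \<le> 0\<close>. Zorn's lemma gives a maximal
dominated subspace, which is then shown to lie over every point of \<open>X\<close>.\<close>

lemma dominated_graph_extends:
  fixes G :: "('a::real_normed_vector \<times> real) set"
  assumes "subspace G" and dom: "\<And>x a. (x, a) \<in> G \<Longrightarrow> a \<le> K * norm x" and "0 \<le> K"
  obtains g where "bounded_linear g" "\<And>x. \<bar>g x\<bar> \<le> K * norm x" "\<And>x a. (x, a) \<in> G \<Longrightarrow> g x = a"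
proof -
  define \<A> where "\<A> = {H. subspace H \<and> G \<subseteq> H \<and> (\<forall>(x, a)\<in>H. a \<le> K * norm x)}"
  have "\<exists>H\<in>\<A>. \<forall>X\<in>\<A>. H \<subseteq> X \<longrightarrow> X = H"
  proof (rule subset_Zorn_nonempty)
    show "\<A> \<noteq> {}" using assms by (auto simp: \<A>_def)
    fix \<C> assume \<C>: "\<C> \<noteq> {}" "subset.chain \<A> \<C>"
    have sub: "H \<in> \<A>" if "H \<in> \<C>" for H using \<C>(2) that by (auto simp: subset.chain_def)
    have two: "\<exists>H\<in>\<C>. u \<in> H \<and> v \<in> H" if "u \<in> \<Union>\<C>" "v \<in> \<Union>\<C>" for u v
      using that \<C>(2) unfolding subset_chain_def by blast
    have "subspace (\<Union>\<C>)"
    proof (rule subspaceI)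
      show "0 \<in> \<Union>\<C>" using \<C>(1) sub by (auto simp: \<A>_def subspace_def)
      show "x + y \<in> \<Union>\<C>" if xy: "x \<in> \<Union>\<C>" "y \<in> \<Union>\<C>" for x y
      proof -
        obtain H where "H \<in> \<C>" "x \<in> H" "y \<in> H" using two[OF xy] by blast
        then show ?thesis using sub[of H] by (auto simp: \<A>_def intro: subspace_add)
      qed
      show "c *\<^sub>R x \<in> \<Union>\<C>" if x: "x \<in> \<Union>\<C>" for x c
      proof -
        obtain H where "H \<in> \<C>" "x \<in> H" using x by blast
        then show ?thesis using sub[of H] by (auto simp: \<A>_def intro: subspace_scale)
      qed
    qed
    moreover have "G \<subseteq> \<Union>\<C>" using \<C>(1) sub by (auto simp: \<A>_def)
    moreover have "a \<le> K * norm x" if "(x, a) \<in> \<Union>\<C>" for x a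
      using that sub by (fastforce simp: \<A>_def)
    ultimately show "\<Union>\<C> \<in> \<A>" by (auto simp: \<A>_def)
  qed
  then obtain H where "H \<in> \<A>" and max: "\<And>X. X \<in> \<A> \<Longrightarrow> H \<subseteq> X \<Longrightarrow> X = H" by blast
  then have H: "subspace H" "G \<subseteq> H" "\<And>x a. (x, a) \<in> H \<Longrightarrow> a \<le> K * norm x"
    by (auto simp: \<A>_def)
  have total: "\<exists>a. (z, a) \<in> H" for z
  proof -
    \<comment> \<open>The value \<open>\<xi>\<close> chosen at \<open>z\<close> has to satisfy \<open>a - K \<parallel>x - z\<parallel> \<le> \<xi> \<le> K \<parallel>y + z\<parallel> - b\<close> for all \<open>(x, a)\<close>
      and \<open>(y, b)\<close> in \<open>H\<close>; the lower bounds are below the upper ones by the triangle inequality.\<close>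
    define D where "D = (\<lambda>(x, a). a - K * norm (x - z)) ` H"
    have ub: "a - K * norm (x - z) \<le> K * norm (y + z) - b" if "(x, a) \<in> H" "(y, b) \<in> H" for x a y b
    proof -
      have "a + b \<le> K * norm (x + y)"
        using H(3)[of "x + y" "a + b"] subspace_add[OF H(1) that] by simp
      also have "\<dots> \<le> K * (norm (x - z) + norm (y + z))"
        using \<open>0 \<le> K\<close> norm_triangle_ineq[of "x - z" "y + z"]
        by (intro mult_left_mono) (auto simp: algebra_simps)
      finally show ?thesis by (simp add: algebra_simps)
    qed
    have zero: "(0, 0) \<in> H" using subspace_0[OF H(1)] by (simp add: zero_prod_def)
    define \<xi> where "\<xi> = Sup D"
    have lo: "a - K * norm (x - z) \<le> \<xi>" if "(x, a) \<in> H" for x a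
      unfolding \<xi>_def using that ub[OF _ zero]
      by (intro cSup_upper bdd_aboveI[of _ "K * norm z"]) (force simp: D_def)+
    have hi: "\<xi> \<le> K * norm (y + z) - b" if "(y, b) \<in> H" for y b
      unfolding \<xi>_def using that ub zero by (intro cSup_least) (auto simp: D_def)
    define H' where "H' = span (insert (z, \<xi>) H)"
    have "a \<le> K * norm x" if "(x, a) \<in> H'" for x a
    proof -
      obtain t where "(x, a) - t *\<^sub>R (z, \<xi>) \<in> span H"
        using \<open>(x, a) \<in> H'\<close> unfolding H'_def span_breakdown_eq by blast
      then have t: "(x - t *\<^sub>R z, a - t * \<xi>) \<in> H" using H(1) by (simp add: span_eq_iff[THEN iffD2])
      consider "t = 0" | "t > 0" | "t < 0" by linarith
      then show ?thesis
      proof cases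
        case 1 then show ?thesis using t H(3) by simp
      next
        case 2
        have "((1/t) *\<^sub>R x - z, a / t - \<xi>) \<in> H"
          using subspace_scale[OF H(1) t, of "1/t"] 2 by (simp add: algebra_simps)
        from hi[OF this] have "a / t \<le> K * (norm x / t)" using 2 by simp
        then show ?thesis using 2 by (simp add: field_simps)
      next
        case 3
        have "((1/(-t)) *\<^sub>R x + z, a / (-t) + \<xi>) \<in> H"
          using subspace_scale[OF H(1) t, of "1/(-t)"] 3 by (simp add: algebra_simps)
        from lo[OF this] have "a / (-t) \<le> K * (norm x / (-t))" using 3 by simp
        then show ?thesis using 3 by (simp add: field_simps)
      qed
    qed
    moreover have "insert (z, \<xi>) H \<subseteq> H'" unfolding H'_def by (rule span_superset)
    ultimately have "H' \<in> \<A>" using H(2) by (auto simp: \<A>_def H'_def)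
    then have "H' = H" using max \<open>insert (z, \<xi>) H \<subseteq> H'\<close> by blast
    then show ?thesis using \<open>insert (z, \<xi>) H \<subseteq> H'\<close> by blast
  qed
  have unique: "a = b" if "(x, a) \<in> H" "(x, b) \<in> H" for x a b
    using H(3)[of 0 "a - b"] H(3)[of 0 "b - a"] subspace_diff[OF H(1) that]
      subspace_diff[OF H(1) that(2,1)] by simp
  define g where "g x = (THE a. (x, a) \<in> H)" for x
  have gH: "(x, g x) \<in> H" for x
    unfolding g_def using total[of x] unique by (metis theI)
  have g_eq: "g x = a" if "(x, a) \<in> H" for x a using unique gH that by blast
  have abs: "\<bar>g x\<bar> \<le> K * norm x" for x
    using H(3)[OF gH, of x] H(3)[of "-x" "- g x"] subspace_neg[OF H(1) gH, of x] by simp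
  have "bounded_linear g"
  proof (rule bounded_linear_intro[where K = K])
    show "g (x + y) = g x + g y" for x y
      using subspace_add[OF H(1) gH gH, of x y] by (intro g_eq) simp
    show "g (r *\<^sub>R x) = r *\<^sub>R g x" for r x
      using subspace_scale[OF H(1) gH, of r x] by (intro g_eq) simp
    show "norm (g x) \<le> norm x * K" for x using abs[of x] by (simp add: mult.commute)
  qed
  then show thesis using that abs g_eq H(2) by blast
qed

section \<open>Complex scalars and subspaces\<close>

definition csubspace :: "'a::complex_normed_vector set \<Rightarrow> bool"
  where "csubspace V \<longleftrightarrow> 0 \<in> V \<and> (\<forall>x\<in>V. \<forall>y\<in>V. x + y \<in> V) \<and> (\<forall>c. \<forall>x\<in>V. c *\<^sub>C x \<in> V)"

lemma csubspaceD:
  assumes "csubspace V"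
  shows "0 \<in> V" "x \<in> V \<Longrightarrow> y \<in> V \<Longrightarrow> x + y \<in> V" "x \<in> V \<Longrightarrow> c *\<^sub>C x \<in> V"
  using assms by (auto simp: csubspace_def)

lemma closed_csubspace_iff: "closed_csubspace M \<longleftrightarrow> closed M \<and> csubspace M"
  by (auto simp: closed_csubspace_def csubspace_def)

lemma csubspace_imp_subspace: "csubspace V \<Longrightarrow> subspace V"
  by (auto simp: csubspace_def subspace_def simp flip: scaleC_of_real)

lemma scaleC_one [simp]: "1 *\<^sub>C x = (x :: 'a::complex_normed_vector)"
  using scaleC_of_real[of 1 x] by simp

lemma scaleC_zero_left [simp]: "0 *\<^sub>C x = (0 :: 'a::complex_normed_vector)"
  using scaleC_of_real[of 0 x] by simp

lemma scaleC_diff_left: "(a - b) *\<^sub>C x = a *\<^sub>C x - b *\<^sub>C (x :: 'a::complex_normed_vector)"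
  using scaleC_add_left[of "a - b" b x] by simp

lemma scaleC_minus_left: "(- a) *\<^sub>C x = - (a *\<^sub>C (x :: 'a::complex_normed_vector))"
  using scaleC_diff_left[of 0 a x] by simp

lemma norm_capply: "norm (capply f x) \<le> norm f * norm x"
  unfolding norm_cblinfun_eq_onorm by (rule onorm[OF bounded_linear_capply])

lemma norm_cblinfun_le: "0 \<le> K \<Longrightarrow> (\<And>x. norm (capply f x) \<le> K * norm x) \<Longrightarrow> norm f \<le> K"
  unfolding norm_cblinfun_eq_onorm by (rule onorm_bound)

lemma make_cblinfun_works:
  assumes "\<And>x y. f (x + y) = f x + f y" "\<And>c x. f (c *\<^sub>C x) = c *\<^sub>C f x"
    "\<And>x. norm (f x) \<le> K * norm x"
  shows "capply (make_cblinfun f) x = f x"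
  by (intro capply_make_cblinfun bounded_linear_intro[where K = K])
    (use assms in \<open>auto simp: mult.commute simp flip: scaleC_of_real\<close>)

section \<open>Bounded complex functionals\<close>

text \<open>The real part \<open>g\<close> of a complex functional \<open>f\<close> determines it by \<open>f x = g x - \<i> g (\<i> x)\<close>. So it suffices to
extend the real part and to define the extension by this formula. The bound on \<open>g\<close> carries
over to the extension, since the latter is real and positive at a suitable rotation of \<open>x\<close>.\<close>

lemma functional_extends:
  fixes f :: "'a::complex_normed_vector \<Rightarrow> complex"
  assumes V: "csubspace V" and "0 \<le> K"
    and add: "\<And>x y. x \<in> V \<Longrightarrow> y \<in> V \<Longrightarrow> f (x + y) = f x + f y"
    and scale: "\<And>c x. x \<in> V \<Longrightarrow> f (c *\<^sub>C x) = c * f x"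
    and bound: "\<And>x. x \<in> V \<Longrightarrow> cmod (f x) \<le> K * norm x"
  obtains \<phi> :: "'a cdual" where "\<And>x. x \<in> V \<Longrightarrow> capply \<phi> x = f x" "norm \<phi> \<le> K"
proof -
  define G where "G = (\<lambda>x. (x, Re (f x))) ` V"
  have "subspace G"
  proof (rule subspaceI)
    show "0 \<in> G"
      using scale[of 0 0] V by (auto simp: G_def csubspace_def zero_prod_def intro!: image_eqI[of _ _ 0])
    show "u + v \<in> G" if uv: "u \<in> G" "v \<in> G" for u v
    proof -
      obtain x y where "x \<in> V" "y \<in> V" "u = (x, Re (f x))" "v = (y, Re (f y))"
        using uv unfolding G_def by blast
      then show ?thesis
        using csubspaceD(2)[OF V] add unfolding G_def by (intro image_eqI[of _ _ "x + y"]) auto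
    qed
    show "c *\<^sub>R u \<in> G" if "u \<in> G" for c u
      using that scale[of _ "complex_of_real c"] V
      by (auto simp: G_def csubspace_def scaleC_of_real intro!: image_eqI[of _ _ "c *\<^sub>R fst u"]
          dest: spec[of _ "complex_of_real c"])
  qed
  moreover have "a \<le> K * norm x" if "(x, a) \<in> G" for x a
    using that bound complex_Re_le_cmod order_trans unfolding G_def by blast
  ultimately obtain g where g: "bounded_linear g" "\<And>x. \<bar>g x\<bar> \<le> K * norm x"
      "\<And>x a. (x, a) \<in> G \<Longrightarrow> g x = a"
    using dominated_graph_extends \<open>0 \<le> K\<close> by metis
  define h where "h x = Complex (g x) (- g (\<i> *\<^sub>C x))" for x
  have hadd: "h (x + y) = h x + h y" for x y
    by (simp add: h_def scaleC_add_right linear_simps(1)[OF g(1)] complex_eq_iff)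
  have hscale: "h (c *\<^sub>C x) = c * h x" for c x
  proof -
    have eq: "c *\<^sub>C y = Re c *\<^sub>R y + Im c *\<^sub>R (\<i> *\<^sub>C y)" for y :: 'a
      by (subst complex_eq[of c])
        (simp add: scaleC_add_left scaleC_scaleC mult.commute flip: scaleC_of_real)
    have g_scale: "g (c *\<^sub>C y) = Re c * g y + Im c * g (\<i> *\<^sub>C y)" for y
      unfolding eq[of y] by (simp add: linear_simps[OF g(1)])
    have "\<i> *\<^sub>C c *\<^sub>C x = c *\<^sub>C \<i> *\<^sub>C x" by (simp add: scaleC_scaleC mult.commute)
    moreover have "\<i> *\<^sub>C \<i> *\<^sub>C x = - x" by (simp add: scaleC_scaleC scaleC_minus_left)
    ultimately have "g (\<i> *\<^sub>C c *\<^sub>C x) = Re c * g (\<i> *\<^sub>C x) - Im c * g x"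
      by (simp add: g_scale linear_simps(4)[OF g(1)] linear_simps(3)[OF g(1)])
    then show ?thesis by (simp add: h_def complex_eq_iff g_scale)
  qed
  have hbound: "cmod (h x) \<le> K * norm x" for x
  proof (cases "h x = 0")
    case False
    \<comment> \<open>Rotate \<open>x\<close> so that \<open>h\<close> takes a positive real value at it.\<close>
    define c where "c = cnj (h x) / cmod (h x)"
    have "cmod c = 1" using False by (simp add: c_def norm_divide)
    have "h (c *\<^sub>C x) = cmod (h x)"
      using False by (simp add: hscale c_def complex_norm_square power2_eq_square mult.commute
          flip: complex_norm_square)
    then have "cmod (h x) = g (c *\<^sub>C x)" by (simp add: h_def complex_eq_iff)
    also have "\<dots> \<le> K * norm x" using g(2)[of "c *\<^sub>C x"] \<open>cmod c = 1\<close> by (simp add: norm_scaleC)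
    finally show ?thesis .
  qed (use \<open>0 \<le> K\<close> in auto)
  have h: "capply (make_cblinfun h) x = h x" for x
    using hadd hscale hbound by (intro make_cblinfun_works[where K = K]) (auto simp: scaleC_complex_def)
  show thesis
  proof (rule that[of "make_cblinfun h"])
    show "norm (make_cblinfun h) \<le> K"
      using \<open>0 \<le> K\<close> hbound by (intro norm_cblinfun_le) (auto simp: h)
    show "capply (make_cblinfun h) x = f x" if "x \<in> V" for x
    proof -
      have "\<i> *\<^sub>C x \<in> V" using V that by (rule csubspaceD)
      then have "g x = Re (f x)" "g (\<i> *\<^sub>C x) = Re (f (\<i> *\<^sub>C x))"
        using that by (auto intro!: g(3) simp: G_def)
      then show ?thesis using scale[OF that, of \<i>] by (simp add: h h_def complex_eq_iff)
    qed
  qed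
qed

text \<open>The functional \<open>v + c x \<mapsto> c\<close> on the span of \<open>V\<close> and \<open>x\<close> is bounded by the reciprocal of the distance
of \<open>x\<close> from \<open>V\<close>, and can therefore be extended to the whole space.\<close>

lemma functional_separates:
  fixes V :: "'a::complex_normed_vector set"
  assumes "closed V" and V: "csubspace V" and "x \<notin> V"
  obtains \<phi> :: "'a cdual" where "\<And>v. v \<in> V \<Longrightarrow> capply \<phi> v = 0" "capply \<phi> x = 1"
proof -
  obtain d where "d > 0" and "ball x d \<subseteq> - V"
    using \<open>closed V\<close> \<open>x \<notin> V\<close> open_contains_ball[of "- V"] by auto
  then have d: "d \<le> dist x v" if "v \<in> V" for v
    using that by (meson ComplD linorder_not_le mem_ball subsetD)
  define W where "W = {y. \<exists>c. y - c *\<^sub>C x \<in> V}"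
  define f where "f y = (SOME c. y - c *\<^sub>C x \<in> V)" for y
  have sub: "u - v \<in> V" if "u \<in> V" "v \<in> V" for u v
    using that V by (intro subspace_diff csubspace_imp_subspace)
  have uniq: "a = b" if "y - a *\<^sub>C x \<in> V" "y - b *\<^sub>C x \<in> V" for a b y
  proof (rule ccontr)
    assume "a \<noteq> b"
    have "(b - a) *\<^sub>C x \<in> V" using sub[OF that] by (simp add: scaleC_diff_left)
    have "inverse (b - a) *\<^sub>C (b - a) *\<^sub>C x \<in> V" using V \<open>(b - a) *\<^sub>C x \<in> V\<close> by (rule csubspaceD(3))
    then show False using \<open>a \<noteq> b\<close> \<open>x \<notin> V\<close> by (simp add: scaleC_scaleC)
  qed
  have f: "f y = c" if "y - c *\<^sub>C x \<in> V" for y c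
    unfolding f_def using that uniq by (metis someI)
  have fW: "y - f y *\<^sub>C x \<in> V" if "y \<in> W" for y
    using that f by (auto simp: W_def)
  have V0: "0 \<in> V" using V by (rule csubspaceD)
  have add: "(y + z) - (a + b) *\<^sub>C x \<in> V" if "y - a *\<^sub>C x \<in> V" "z - b *\<^sub>C x \<in> V" for y z a b
    using csubspaceD(2)[OF V that] by (simp add: scaleC_add_left algebra_simps)
  have scale: "c *\<^sub>C y - (c * a) *\<^sub>C x \<in> V" if "y - a *\<^sub>C x \<in> V" for y a c
    using csubspaceD(3)[OF V that, of c] by (simp add: scaleC_diff_right scaleC_scaleC)
  have W: "csubspace W"
  proof (unfold csubspace_def, intro conjI ballI allI)
    show "0 \<in> W" using V0 by (auto simp: W_def intro!: exI[of _ 0])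
    show "y + z \<in> W" if "y \<in> W" "z \<in> W" for y z
      using that add unfolding W_def by blast
    show "c *\<^sub>C y \<in> W" if "y \<in> W" for c y
      using that scale unfolding W_def by blast
  qed
  have f_bound: "cmod (f y) \<le> (1 / d) * norm y" if "y \<in> W" for y
  proof (cases "f y = 0")
    case False
    let ?v = "inverse (- f y) *\<^sub>C (y - f y *\<^sub>C x)"
    have "?v = x - inverse (f y) *\<^sub>C y"
      using False by (simp add: scaleC_diff_right scaleC_scaleC scaleC_minus_left)
    moreover have "?v \<in> V" using V fW[OF that] by (rule csubspaceD(3))
    ultimately have "d \<le> norm (inverse (f y) *\<^sub>C y)"
      using d[of ?v] by (simp add: dist_norm)
    then show ?thesis using False \<open>d > 0\<close> by (simp add: norm_scaleC norm_inverse norm_divide field_simps)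
  qed (use \<open>d > 0\<close> in auto)
  obtain \<phi> :: "'a cdual" where \<phi>: "\<And>y. y \<in> W \<Longrightarrow> capply \<phi> y = f y"
    by (rule functional_extends[OF W _ _ _ f_bound]) (use add scale f fW \<open>d > 0\<close> in auto)
  show thesis
  proof (rule that[of \<phi>])
    show "capply \<phi> v = 0" if "v \<in> V" for v
    proof -
      have "v - 0 *\<^sub>C x \<in> V" using that by simp
      then have "v \<in> W" "f v = 0" using f[of v 0] unfolding W_def by blast+
      then show ?thesis using \<phi> by simp
    qed
    show "capply \<phi> x = 1"
    proof -
      have "x - 1 *\<^sub>C x \<in> V" using V0 by simp
      then have "x \<in> W" "f x = 1" using f[of x 1] unfolding W_def by blast+
      then show ?thesis using \<phi> by simp
    qed
  qed
qed

section \<open>The open mapping theorem\<close>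

text \<open>The open mapping theorem for the restriction of \<open>L\<close> to a closed subspace with closed image, in the
form in which it is used below. By Baire's theorem, the closure of the image of some ball contains
a relative ball of \<open>L ` S\<close>, which symmetry and convexity move to the origin. So every \<open>y\<close> in the image
has an approximate preimage of comparable norm with an error of at most half the norm of \<open>y\<close>;
summing the corrections for the successive errors gives an exact one.\<close>

lemma bounded_preimages:
  fixes L :: "'a::banach \<Rightarrow> 'b::banach"
  assumes L: "bounded_linear L" and S: "closed S" "subspace S" and clo: "closed (L ` S)"
  obtains C where "C > 0" "\<And>y. y \<in> L ` S \<Longrightarrow> \<exists>x\<in>S. L x = y \<and> norm x \<le> C * norm y"
proof -
  note lin = bounded_linear.linear[OF L]
  define Z where "Z = L ` S"
  have Z: "subspace Z" "closed Z"
    using lin S clo by (auto simp: Z_def intro: linear_subspace_image)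
  define F where "F n = closure (L ` (S \<inter> cball 0 (real n)))" for n :: nat
  have FZ: "F n \<subseteq> Z" for n
    unfolding F_def using Z by (intro closure_minimal) (auto simp: Z_def)
  have "\<exists>n. top_of_set Z interior_of F n \<noteq> {}"
  proof (rule ccontr)
    assume empty: "\<not> ?thesis"
    have "top_of_set Z interior_of \<Union>(range F) = {}"
    proof (rule Baire_category_alt)
      have "completely_metrizable_space (top_of_set Z)"
        using Z(2) by (intro completely_metrizable_space_closedin
            completely_metrizable_space_euclidean) simp
      then show "completely_metrizable_space (top_of_set Z) \<or>
          locally_compact_space (top_of_set Z) \<and> regular_space (top_of_set Z)" ..
      show "closedin (top_of_set Z) T \<and> top_of_set Z interior_of T = {}" if "T \<in> range F" for T
        using that empty FZ by (auto simp: F_def intro!: closed_subset)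
    qed auto
    moreover have "\<Union>(range F) = Z"
    proof
      show "Z \<subseteq> \<Union>(range F)"
      proof
        fix y assume "y \<in> Z"
        then obtain x where x: "x \<in> S" "y = L x" by (auto simp: Z_def)
        obtain n :: nat where "norm x \<le> n" using real_arch_simple by blast
        then have "y \<in> L ` (S \<inter> cball 0 (real n))" using x by auto
        then have "y \<in> F n" unfolding F_def by (rule subsetD[OF closure_subset])
        then show "y \<in> \<Union>(range F)" by blast
      qed
    qed (use FZ in blast)
    moreover have "0 \<in> Z" using Z by (rule_tac subspace_0)
    ultimately show False
      by (metis empty_iff interior_of_topspace topspace_euclidean_subtopology)
  qed
  then obtain n z where "z \<in> top_of_set Z interior_of F n" by blast
  then obtain U where U: "open U" "z \<in> U" "U \<inter> Z \<subseteq> F n" "z \<in> Z"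
    unfolding interior_of_def by (auto simp: openin_open Int_commute)
  then obtain \<delta> where "\<delta> > 0" and \<delta>: "ball z \<delta> \<subseteq> U" using open_contains_ball by blast
  have conv: "convex (F n)"
    unfolding F_def using lin S
    by (intro convex_closure convex_linear_image convex_Int subspace_imp_convex convex_cball)
  have sym: "- y \<in> F n" if "y \<in> F n" for y
  proof -
    have "uminus ` L ` (S \<inter> cball 0 (real n)) \<subseteq> L ` (S \<inter> cball 0 (real n))"
      using S(2) by (auto simp: linear_neg[OF lin, symmetric] subspace_neg)
    then have "uminus ` F n \<subseteq> F n"
      unfolding F_def using closure_subset
      by (intro image_closure_subset continuous_intros closed_closure) (rule order_trans)
    then show ?thesis using that by blast
  qed
  have ball: "y \<in> F n" if "y \<in> Z" "norm y < \<delta>" for y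
  proof -
    have "z + y \<in> F n" "z - y \<in> F n"
      using that U \<delta> Z by (auto intro!: subsetD[OF U(3)] subsetD[OF \<delta>] simp: dist_norm subspace_add subspace_diff)
    then have "(1/2) *\<^sub>R (z + y) + (1/2) *\<^sub>R (- (z - y)) \<in> F n"
      using conv sym[OF \<open>z - y \<in> F n\<close>] \<open>z + y \<in> F n\<close> by (intro convexD) simp_all
    then show ?thesis by (simp add: algebra_simps flip: scaleR_add_left)
  qed
  define C where "C = 2 * real n / \<delta>"
  have "C \<ge> 0" using \<open>\<delta> > 0\<close> by (simp add: C_def)
  have "\<exists>x\<in>S. norm x \<le> C * norm y \<and> norm (y - L x) \<le> norm y / 2" if "y \<in> Z" for y
  proof (cases "y = 0")
    case True
    then show ?thesis using S(2) lin by (intro bexI[of _ 0]) (auto simp: linear_0 subspace_0)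
  next
    case False
    define t where "t = 2 * norm y / \<delta>"
    have "t > 0" using False \<open>\<delta> > 0\<close> by (simp add: t_def)
    have "(1/t) *\<^sub>R y \<in> F n"
      using that False \<open>\<delta> > 0\<close> Z by (intro ball) (auto simp: t_def subspace_scale)
    then obtain x where x: "x \<in> S" "norm x \<le> n" "dist (L x) ((1/t) *\<^sub>R y) < \<delta> / 4"
      unfolding F_def closure_approachable using \<open>\<delta> > 0\<close>
      by (force dest: spec[of _ "\<delta> / 4"])
    have "y - L (t *\<^sub>R x) = t *\<^sub>R ((1/t) *\<^sub>R y - L x)"
      using \<open>t > 0\<close> by (simp add: linear_scale[OF lin] algebra_simps)
    then have "norm (y - L (t *\<^sub>R x)) \<le> t * (\<delta> / 4)"
      using x(3) \<open>t > 0\<close> by (simp add: dist_norm norm_minus_commute)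
    moreover have "norm (t *\<^sub>R x) \<le> t * n" using x(2) \<open>t > 0\<close> by simp
    ultimately show ?thesis
      using x(1) S(2) \<open>\<delta> > 0\<close>
      by (intro bexI[of _ "t *\<^sub>R x"]) (auto simp: t_def C_def subspace_scale field_simps)
  qed
  then obtain h where h: "\<And>y. y \<in> Z \<Longrightarrow> h y \<in> S" "\<And>y. y \<in> Z \<Longrightarrow> norm (h y) \<le> C * norm y"
      "\<And>y. y \<in> Z \<Longrightarrow> norm (y - L (h y)) \<le> norm y / 2"
    by metis
  show thesis
  proof (rule that[of "2 * C + 1"])
    show "2 * C + 1 > 0" using \<open>C \<ge> 0\<close> by simp
    fix y assume "y \<in> L ` S"
    define Y where "Y k = ((\<lambda>y. y - L (h y)) ^^ k) y" for k
    have Y0: "Y 0 = y" and YS: "Y (Suc k) = Y k - L (h (Y k))" for k by (auto simp: Y_def)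
    have YZ: "Y k \<in> Z" for k
      using \<open>y \<in> L ` S\<close> Z(1) h(1) by (induction k) (auto simp: Y0 YS Z_def intro!: subspace_diff)
    have Yn: "norm (Y k) \<le> norm y * (1/2) ^ k" for k
    proof (induction k)
      case (Suc k)
      then show ?case using h(3)[OF YZ, of k] by (simp add: YS)
    qed (simp add: Y0)
    have bound: "norm (h (Y k)) \<le> C * norm y * (1/2) ^ k" for k
      using h(2)[OF YZ, of k] mult_left_mono[OF Yn \<open>C \<ge> 0\<close>, of k] by simp
    have geo: "(\<lambda>k. C * norm y * (1/2) ^ k) sums (C * norm y * 2)"
      using sums_mult[OF geometric_sums[of "1/2::real"], of "C * norm y"] by simp
    have "summable (\<lambda>k. h (Y k))"
      by (rule summable_comparison_test'[OF sums_summable[OF geo], of 0]) (rule bound)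
    then have x: "(\<lambda>k. h (Y k)) sums (\<Sum>k. h (Y k))" by (rule summable_sums)
    define x where "x = (\<Sum>k. h (Y k))"
    have "norm x \<le> C * norm y * 2"
      unfolding x_def using bound norm_suminf_le[OF bound sums_summable[OF geo]] sums_unique[OF geo]
      by simp
    moreover have "x \<in> S"
      unfolding x_def
      by (rule closed_sequentially[OF S(1) _ x[unfolded sums_def]])
        (use S(2) h(1) YZ in \<open>auto intro!: subspace_sum\<close>)
    moreover have "L x = y"
    proof (rule sums_unique2)
      show "(\<lambda>k. L (h (Y k))) sums L x" using bounded_linear.sums[OF L x] by (simp add: x_def)
      have "Y \<longlonglongrightarrow> 0"
        using Yn by (rule_tac Lim_null_comparison[of _ "\<lambda>k. norm y * (1/2) ^ k"])
          (auto intro!: tendsto_mult_right_zero LIMSEQ_realpow_zero)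
      then have "(\<lambda>k. Y k - Y (Suc k)) sums (Y 0 - 0)" by (rule telescope_sums')
      then show "(\<lambda>k. L (h (Y k))) sums y" by (simp add: YS Y0)
    qed
    ultimately show "\<exists>x\<in>S. L x = y \<and> norm x \<le> (2 * C + 1) * norm y"
      by (intro bexI[of _ x]) (auto simp: algebra_simps intro: add_increasing)
  qed
qed

lemma cinvertible_if_bij:
  fixes A :: "'a::complex_banach \<Rightarrow>\<^sub>C\<^sub>L 'a"
  assumes "bij (capply A)"
  shows "cinvertible A"
proof -
  have surj: "surj (capply A)" and inj: "inj (capply A)" using assms by (auto simp: bij_def)
  have "closed (range (capply A))" using surj by simp
  then obtain C where "\<And>y. y \<in> range (capply A) \<Longrightarrow> \<exists>x\<in>UNIV. capply A x = y \<and> norm x \<le> C * norm y"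
    using bounded_preimages[OF bounded_linear_capply closed_UNIV subspace_UNIV] by blast
  then have C: "\<exists>x. capply A x = y \<and> norm x \<le> C * norm y" for y using surj by auto
  define B where "B = inv (capply A)"
  have AB: "capply A (B y) = y" for y using surj by (simp add: B_def surj_f_inv_f)
  have BA: "B (capply A y) = y" for y using inj by (simp add: B_def)
  have "norm (B y) \<le> C * norm y" for y using C[of y] BA by metis
  moreover have "B (x + y) = B x + B y" for x y
    using BA[of "B x + B y"] by (simp add: linear_simps(1)[OF bounded_linear_capply] AB)
  moreover have "B (c *\<^sub>C x) = c *\<^sub>C B x" for c x
    using BA[of "c *\<^sub>C B x"] by (simp add: capply_scaleC AB)
  ultimately have "capply (make_cblinfun B) x = B x" for x
    by (intro make_cblinfun_works)
  then show ?thesis unfolding cinvertible_def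
    by (intro exI[of _ "make_cblinfun B"]) (auto intro!: cblinfun_eqI simp: capply_compose capply_id AB BA)
qed

text \<open>The projection is bounded because addition maps \<open>M \<times> N\<close> onto the whole space, so that
decompositions of comparable norm exist, and decompositions are unique.\<close>

lemma bounded_projection:
  fixes M N :: "'a::complex_banach set"
  assumes M: "closed_csubspace M" and N: "closed_csubspace N"
    and int: "M \<inter> N = {0}" and sum: "{x + y |x y. x \<in> M \<and> y \<in> N} = UNIV"
  obtains P :: "'a \<Rightarrow>\<^sub>C\<^sub>L 'a" where "\<And>x. capply P x \<in> M" "\<And>x. x - capply P x \<in> N"
    "\<And>x. x \<in> M \<Longrightarrow> capply P x = x" "\<And>x. x \<in> N \<Longrightarrow> capply P x = 0"
proof -
  note M' = M[unfolded closed_csubspace_iff] and N' = N[unfolded closed_csubspace_iff]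
  note Ms = csubspace_imp_subspace[OF M'[THEN conjunct2]] and Ns = csubspace_imp_subspace[OF N'[THEN conjunct2]]
  define L where "L p = fst p + snd p" for p :: "'a \<times> 'a"
  have "bounded_linear L"
    unfolding L_def by (intro bounded_linear_add bounded_linear_fst bounded_linear_snd)
  moreover have "L ` (M \<times> N) = UNIV" using sum by (force simp: L_def image_iff)
  moreover have "closed (M \<times> N)" "subspace (M \<times> N)"
    using M' N' Ms Ns by (auto intro: closed_Times subspace_Times)
  ultimately obtain C where C: "\<And>y. \<exists>p\<in>M \<times> N. L p = y \<and> norm p \<le> C * norm y"
    using bounded_preimages[of L "M \<times> N"] by (metis UNIV_I closed_UNIV)
  have ex: "\<exists>u. u \<in> M \<and> x - u \<in> N \<and> norm u \<le> C * norm x" for x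
  proof -
    obtain u v where "u \<in> M" "v \<in> N" "u + v = x" "norm (u, v) \<le> C * norm x"
      using C[of x] by (auto simp: L_def)
    then show ?thesis using norm_fst_le[of "u" "v"] by (intro exI[of _ u]) auto
  qed
  then obtain p where p: "\<And>x. p x \<in> M" "\<And>x. x - p x \<in> N" "\<And>x. norm (p x) \<le> C * norm x"
    by metis
  have uniq: "p x = u" if "u \<in> M" "x - u \<in> N" for x u
  proof -
    have "p x - u \<in> M" using p(1) that(1) Ms by (intro subspace_diff)
    moreover have "(x - u) - (x - p x) \<in> N" using Ns that(2) p(2) by (rule subspace_diff)
    ultimately show ?thesis using int by force
  qed
  have "p (x + y) = p x + p y" for x y
    using p Ms subspace_add[OF Ns p(2) p(2), of x y]
    by (intro uniq) (auto intro: subspace_add simp: algebra_simps)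
  moreover have "p (c *\<^sub>C x) = c *\<^sub>C p x" for c x
    using p csubspaceD(3)[OF M'[THEN conjunct2]] csubspaceD(3)[OF N'[THEN conjunct2] p(2), of c x]
    by (intro uniq) (auto simp: scaleC_diff_right)
  ultimately have P: "capply (make_cblinfun p) x = p x" for x
    using p(3) by (intro make_cblinfun_works)
  show thesis
    by (rule that[of "make_cblinfun p"])
      (use p uniq Ms Ns in \<open>auto simp: P subspace_0\<close>)
qed

section \<open>Inverses in complex Banach algebras\<close>

text \<open>The unit may be equal to \<open>0\<close>, so that the operators on the zero space form such an algebra, too.\<close>

class complex_banach_algebra = complex_banach + real_normed_algebra + monoid_mult +
  assumes mult_scaleC_left: "(c *\<^sub>C x) * y = c *\<^sub>C (x * y)"
    and mult_scaleC_right: "x * (c *\<^sub>C y) = c *\<^sub>C (x * y)"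

definition binvertible :: "'a::complex_banach_algebra \<Rightarrow> bool"
  where "binvertible a \<longleftrightarrow> (\<exists>b. a * b = 1 \<and> b * a = 1)"

definition binv :: "'a::complex_banach_algebra \<Rightarrow> 'a"
  where "binv a = (SOME b. a * b = 1 \<and> b * a = 1)"

lemma binv:
  assumes "binvertible a"
  shows binv_right: "a * binv a = 1" and binv_left: "binv a * a = 1"
  using someI_ex[OF assms[unfolded binvertible_def]] by (auto simp: binv_def)

lemma binvertibleI:
  assumes "a * b = 1" "c * a = 1"
  shows "binvertible a"
proof -
  have "c = c * (a * b)" by (simp add: assms)
  also have "\<dots> = (c * a) * b" by (simp only: mult.assoc)
  finally have "c = b" by (simp add: assms)
  then show ?thesis using assms unfolding binvertible_def by blast
qed

lemma binv_unique:
  assumes "a * b = 1" "b * a = 1"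
  shows "binv a = b"
proof -
  have a: "binvertible a" using assms by (rule binvertibleI)
  have "binv a = binv a * (a * b)" by (simp add: assms)
  also have "\<dots> = (binv a * a) * b" by (simp only: mult.assoc)
  finally show ?thesis by (simp add: binv_left[OF a])
qed

lemma
  assumes "binvertible a" "binvertible b"
  shows binvertible_mult: "binvertible (a * b)"
    and binv_mult: "binv (a * b) = binv b * binv a"
proof -
  have "a * b * (binv b * binv a) = 1"
    by (metis assms binv_right mult.assoc mult_1_right)
  moreover have "binv b * binv a * (a * b) = 1"
    by (metis assms binv_left mult.assoc mult_1_right)
  ultimately show "binvertible (a * b)" "binv (a * b) = binv b * binv a"
    by (auto intro: binvertibleI binv_unique)
qed

text \<open>The commutation provides an inverse of \<open>x\<close> on either side.\<close>

lemma binvertible_factor: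
  assumes "binvertible (x * y)" "x * y = y * x"
  shows "binvertible x"
  by (rule binvertibleI[of x "y * binv (x * y)" "binv (x * y) * y"])
    (metis assms binv_right mult.assoc, metis assms binv_left mult.assoc)

lemma binv_commute:
  assumes "binvertible a" "x * a = a * x"
  shows "x * binv a = binv a * x"
proof -
  have "x * binv a = binv a * (a * x) * binv a"
    by (simp only: mult.assoc[symmetric] binv_left[OF assms(1)] mult_1_left)
  also have "\<dots> = binv a * x"
    by (simp only: assms(2)[symmetric]) (simp only: mult.assoc binv_right[OF assms(1)] mult_1_right)
  finally show ?thesis .
qed

lemma binvertible_scaleC:
  assumes "binvertible a" "c \<noteq> 0"
  shows "binvertible (c *\<^sub>C a)"
  by (rule binvertibleI[of _ "inverse c *\<^sub>C binv a" "inverse c *\<^sub>C binv a"])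
    (use assms in \<open>simp_all add: mult_scaleC_left mult_scaleC_right scaleC_scaleC binv\<close>)

text \<open>The inverses on the two sides are the fixed points of the contractions \<open>b \<mapsto> 1 + u b\<close> and
\<open>c \<mapsto> 1 + c u\<close>.\<close>

lemma binvertible_one_minus:
  fixes u :: "'a::complex_banach_algebra"
  assumes "norm u < 1"
  shows "binvertible (1 - u)"
proof -
  have "\<exists>!b. 1 + u * b = b"
  proof (rule banach_fix_type[of "norm u"])
    show "\<forall>x y. dist (1 + u * x) (1 + u * y) \<le> norm u * dist x y"
      using norm_mult_ineq[of u] by (auto simp: dist_norm simp flip: right_diff_distrib)
  qed (use assms in auto)
  moreover have "\<exists>!c. 1 + c * u = c"
  proof (rule banach_fix_type[of "norm u"])
    show "\<forall>x y. dist (1 + x * u) (1 + y * u) \<le> norm u * dist x y"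
      using norm_mult_ineq[of _ u]
      by (auto simp: dist_norm mult.commute[of "norm u"] simp flip: left_diff_distrib)
  qed (use assms in auto)
  ultimately obtain b c where "1 + u * b = b" "1 + c * u = c" by blast
  then have "(1 - u) * b = 1" "c * (1 - u) = 1" by (auto simp: algebra_simps)
  then show ?thesis by (rule binvertibleI)
qed

text \<open>The inductive step is the factorization \<open>1 - x x = (1 - x) (1 + x)\<close>.\<close>

lemma binvertible_one_minus_if_power:
  fixes y :: "'a::complex_banach_algebra"
  assumes "binvertible (1 - y ^ (2 ^ k))"
  shows "binvertible (1 - y)"
  using assms
proof (induction k)
  case (Suc k)
  define x where "x = y ^ (2 ^ k)"
  have "y ^ (2 ^ Suc k) = x * x" by (simp add: x_def mult_2 power_add)
  then have "1 - y ^ (2 ^ Suc k) = (1 - x) * (1 + x)" by (simp add: algebra_simps)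
  then have "binvertible (1 - x)"
    using Suc.prems by (intro binvertible_factor[of "1 - x" "1 + x"]) (auto simp: algebra_simps)
  then show ?case using Suc.IH by (simp add: x_def)
qed simp

lemma power_scaleC:
  fixes x :: "'a::complex_banach_algebra"
  shows "(c *\<^sub>C x) ^ n = (c ^ n) *\<^sub>C x ^ n"
  by (induction n) (auto simp: mult_scaleC_left mult_scaleC_right scaleC_scaleC mult.commute)

lemma norm_cis_diff_le: "cmod (cis s - cis t) \<le> \<bar>s - t\<bar>"
proof -
  have "cis s - cis t = cis t * (cis (s - t) - 1)"
    by (simp add: right_diff_distrib cis_mult)
  then have "cmod (cis s - cis t) = cmod (exp (\<i> * complex_of_real (s - t)) - 1)"
    by (simp add: norm_mult cis_conv_exp)
  also have "\<dots> = 2 * \<bar>sin ((s - t) / 2)\<bar>" by (rule dist_exp_i_1)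
  also have "\<dots> \<le> 2 * \<bar>(s - t) / 2\<bar>" using abs_sin_x_le_abs_x[of "(s - t) / 2"] by simp
  finally show ?thesis by simp
qed

section \<open>Dyadic means of the resolvent on a circle\<close>

text \<open>By partial fractions this is the mean of \<open>(1 - \<omega> b)\<^sup>-\<^sup>1\<close> over the \<open>2^k\<close> numbers \<open>\<omega>\<close> with
\<open>\<omega>^(2^k) = cis t\<close>, that is, a Riemann sum of the resolvent of \<open>b\<close> over the unit circle. The argument \<open>t\<close>
makes this family closed under halving: the sum for \<open>k + 1\<close> at \<open>t\<close> is expressed by those
for \<open>k\<close> at the two half angles \<open>t/2\<close> and \<open>t/2 + pi\<close> of \<open>t\<close>, whose \<open>cis\<close> values are the
square roots of \<open>cis t\<close>.\<close>

definition power_resolvent :: "'a::complex_banach_algebra \<Rightarrow> nat \<Rightarrow> real \<Rightarrow> 'a"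
  where "power_resolvent b k t = binv (1 - cis t *\<^sub>C b ^ (2 ^ k))"

context
  fixes b :: "'a::complex_banach_algebra"
  assumes circle: "\<And>t. binvertible (1 - cis t *\<^sub>C b)"
begin

lemma square_factors:
  defines "x k t \<equiv> cis t *\<^sub>C b ^ (2 ^ k)"
  shows "(1 - x k (t/2)) * (1 - x k (t/2 + pi)) = 1 - x (Suc k) t"
    and "(1 - x k (t/2)) + (1 - x k (t/2 + pi)) = 2 *\<^sub>R 1"
    and "x k s * x k t = x k t * x k s"
proof -
  have neg: "x k (t/2 + pi) = - x k (t/2)"
    by (simp add: x_def scaleC_minus_left flip: cis_mult)
  have "x k (t/2) * x k (t/2) = x (Suc k) t"
    by (simp add: x_def mult_scaleC_left mult_scaleC_right scaleC_scaleC cis_mult mult_2 power_add)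
  then show "(1 - x k (t/2)) * (1 - x k (t/2 + pi)) = 1 - x (Suc k) t"
    unfolding neg by (simp add: algebra_simps)
  show "(1 - x k (t/2)) + (1 - x k (t/2 + pi)) = 2 *\<^sub>R 1"
    by (simp add: neg scaleR_2)
  show "x k s * x k t = x k t * x k s"
    by (simp add: x_def mult_scaleC_left mult_scaleC_right scaleC_scaleC mult.commute)
qed

lemma circle_power: "binvertible (1 - cis t *\<^sub>C b ^ (2 ^ k))"
proof (induction k arbitrary: t)
  case (Suc k)
  show ?case unfolding square_factors(1)[symmetric] by (intro binvertible_mult Suc)
qed (simp add: circle)

lemmas power_resolvent_right = binv_right[OF circle_power, folded power_resolvent_def]
  and power_resolvent_left = binv_left[OF circle_power, folded power_resolvent_def]

lemma power_resolvent_commute: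
  assumes "y * b = b * y"
  shows "y * power_resolvent b k t = power_resolvent b k t * y"
proof -
  have "y * b ^ (2 ^ k) = b ^ (2 ^ k) * y" using assms by (metis power_commuting_commutes)
  then show ?thesis
    unfolding power_resolvent_def
    by (intro binv_commute circle_power) (simp add: algebra_simps mult_scaleC_left mult_scaleC_right)
qed

lemma power_resolvent_mult:
  "power_resolvent b k (t/2) * power_resolvent b k (t/2 + pi) = power_resolvent b (Suc k) t"
proof -
  let ?u = "1 - cis (t/2) *\<^sub>C b ^ (2 ^ k)" and ?v = "1 - cis (t/2 + pi) *\<^sub>C b ^ (2 ^ k)"
  have uv: "?u * ?v = ?v * ?u" using square_factors(3) by (simp add: algebra_simps)
  have "binv (?v * ?u) = binv ?u * binv ?v"
    by (intro binv_mult circle_power)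
  then show ?thesis by (simp only: power_resolvent_def uv[symmetric] square_factors(1))
qed

text \<open>Since \<open>u + v = 2\<close> for the two factors \<open>u\<close> and \<open>v\<close> of \<open>1 - cis t b^(2^(k+1))\<close>, one has
\<open>u\<^sup>-\<^sup>1 + v\<^sup>-\<^sup>1 = u\<^sup>-\<^sup>1 (v + u) v\<^sup>-\<^sup>1 = 2 u\<^sup>-\<^sup>1 v\<^sup>-\<^sup>1\<close>.\<close>

lemma power_resolvent_average:
  "power_resolvent b (Suc k) t =
    (1/2) *\<^sub>R (power_resolvent b k (t/2) + power_resolvent b k (t/2 + pi))"
proof -
  let ?u = "1 - cis (t/2) *\<^sub>C b ^ (2 ^ k)" and ?v = "1 - cis (t/2 + pi) *\<^sub>C b ^ (2 ^ k)"
  let ?r = "power_resolvent b k (t/2)" and ?s = "power_resolvent b k (t/2 + pi)"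
  have "?r + ?s = ?r * (?v * ?s) + ?r * ?u * ?s"
    by (simp only: power_resolvent_right power_resolvent_left mult_1_left mult_1_right)
  also have "\<dots> = ?r * (?u + ?v) * ?s" by (simp add: ring_distribs mult.assoc)
  also have "\<dots> = 2 *\<^sub>R (?r * ?s)" by (simp only: square_factors(2)) simp
  finally show ?thesis by (simp add: power_resolvent_mult)
qed

text \<open>The resolvent identity.\<close>

lemma power_resolvent_diff:
  "power_resolvent b 0 s - power_resolvent b 0 t =
    (cis s - cis t) *\<^sub>C (power_resolvent b 0 s * b * power_resolvent b 0 t)"
proof -
  let ?r = "power_resolvent b 0 s" and ?s = "power_resolvent b 0 t"
  have "?r - ?s = ?r * ((1 - cis t *\<^sub>C b) * ?s) - ?r * (1 - cis s *\<^sub>C b) * ?s"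
    using power_resolvent_right[where k = 0 and t = t] power_resolvent_left[where k = 0 and t = s] by simp
  also have "\<dots> = ?r * ((1 - cis t *\<^sub>C b) - (1 - cis s *\<^sub>C b)) * ?s"
    by (simp only: left_diff_distrib right_diff_distrib mult.assoc)
  also have "(1 - cis t *\<^sub>C b) - (1 - cis s *\<^sub>C b) = (cis s - cis t) *\<^sub>C b"
    by (simp add: scaleC_diff_left)
  finally show ?thesis by (simp add: mult_scaleC_left mult_scaleC_right)
qed

lemma norm_power_resolvent_diff:
  "norm (power_resolvent b 0 s - power_resolvent b 0 t) \<le>
    \<bar>s - t\<bar> * (norm (power_resolvent b 0 s) * norm b * norm (power_resolvent b 0 t))"
proof -
  have "norm (power_resolvent b 0 s * b * power_resolvent b 0 t) \<le>
      norm (power_resolvent b 0 s) * norm b * norm (power_resolvent b 0 t)"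
    by (intro order_trans[OF norm_mult_ineq] mult_right_mono norm_mult_ineq norm_ge_zero)
  then show ?thesis
    unfolding power_resolvent_diff norm_scaleC by (intro mult_mono norm_cis_diff_le) auto
qed

text \<open>By the resolvent identity, \<open>\<parallel>g s\<parallel> - \<parallel>g t\<parallel>\<close> is at most \<open>\<bar>s - t\<bar> \<parallel>b\<parallel> \<parallel>g t\<parallel> \<parallel>g s\<parallel>\<close> for the resolvent \<open>g\<close>, and
the factor in front of \<open>\<parallel>g s\<parallel>\<close> is at most \<open>1/2\<close> for \<open>s\<close> near \<open>t\<close>.\<close>

lemma power_resolvent_locally_bounded:
  "\<exists>d>0. \<forall>s. \<bar>s - t\<bar> < d \<longrightarrow> norm (power_resolvent b 0 s) \<le> 2 * norm (power_resolvent b 0 t)"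
proof -
  let ?c = "norm b * norm (power_resolvent b 0 t)"
  define d where "d = 1 / (2 * (?c + 1))"
  have "?c \<ge> 0" by simp
  then have "d > 0" by (simp add: d_def add_nonneg_pos)
  have dc: "d * ?c \<le> 1 / 2" 
  proof -
    have "1 / (2 * (c + 1)) * c \<le> 1 / 2" if "c \<ge> 0" for c :: real
      using that by (simp add: field_simps)
    then show ?thesis unfolding d_def using \<open>?c \<ge> 0\<close> .
  qed
  have "norm (power_resolvent b 0 s) \<le> 2 * norm (power_resolvent b 0 t)" if "\<bar>s - t\<bar> < d" for s
  proof -
    have "norm (power_resolvent b 0 s) - norm (power_resolvent b 0 t) \<le>
        \<bar>s - t\<bar> * (norm (power_resolvent b 0 s) * ?c)"
      using norm_power_resolvent_diff[of s t]
        norm_triangle_ineq2[of "power_resolvent b 0 s" "power_resolvent b 0 t"]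
      by (simp add: mult.assoc)
    also have "\<dots> \<le> d * (norm (power_resolvent b 0 s) * ?c)" using that by (intro mult_right_mono) auto
    also have "\<dots> = norm (power_resolvent b 0 s) * (d * ?c)" by simp
    also have "\<dots> \<le> norm (power_resolvent b 0 s) * (1 / 2)" by (intro mult_left_mono dc) simp
    finally show ?thesis by simp
  qed
  then show ?thesis using \<open>d > 0\<close> by blast
qed

text \<open>On the compact interval the resolvent is bounded because it is locally bounded, and taking means
preserves the bound: the interval \<open>[0, 2 pi]\<close> contains with \<open>t\<close> also \<open>t/2\<close> and \<open>t/2 + pi\<close>.\<close>

lemma power_resolvent_bounded:
  obtains C where "C > 0" "\<And>k t. 0 \<le> t \<Longrightarrow> t \<le> 2 * pi \<Longrightarrow> norm (power_resolvent b k t) \<le> C"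
proof -
  have "(0::real) \<le> 2 * pi" by simp
  then have "\<exists>C. \<forall>t. 0 \<le> t \<and> t \<le> 2 * pi \<longrightarrow> norm (power_resolvent b 0 t) \<le> C"
  proof (rule Bolzano[where P = "\<lambda>u v. \<exists>C. \<forall>t. u \<le> t \<and> t \<le> v \<longrightarrow> norm (power_resolvent b 0 t) \<le> C"])
    fix u v w
    assume "\<exists>C. \<forall>t. u \<le> t \<and> t \<le> v \<longrightarrow> norm (power_resolvent b 0 t) \<le> C"
      "\<exists>C. \<forall>t. v \<le> t \<and> t \<le> w \<longrightarrow> norm (power_resolvent b 0 t) \<le> C"
    then obtain C D where "\<forall>t. u \<le> t \<and> t \<le> v \<longrightarrow> norm (power_resolvent b 0 t) \<le> C"
        "\<forall>t. v \<le> t \<and> t \<le> w \<longrightarrow> norm (power_resolvent b 0 t) \<le> D" by blast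
    then show "\<exists>C. \<forall>t. u \<le> t \<and> t \<le> w \<longrightarrow> norm (power_resolvent b 0 t) \<le> C"
      by (intro exI[of _ "max C D"]) (metis le_max_iff_disj linear)
  next
    fix x
    obtain d where "d > 0" and d: "\<And>s. \<bar>s - x\<bar> < d \<Longrightarrow> norm (power_resolvent b 0 s) \<le> 2 * norm (power_resolvent b 0 x)"
      using power_resolvent_locally_bounded by blast
    have "\<exists>C. \<forall>t. u \<le> t \<and> t \<le> v \<longrightarrow> norm (power_resolvent b 0 t) \<le> C"
      if "u \<le> x" "x \<le> v" "v - u < d" for u v
      using d that by (intro exI[of _ "2 * norm (power_resolvent b 0 x)"]) auto
    then show "\<exists>d>0. \<forall>u v. u \<le> x \<and> x \<le> v \<and> v - u < d \<longrightarrow>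
        (\<exists>C. \<forall>t. u \<le> t \<and> t \<le> v \<longrightarrow> norm (power_resolvent b 0 t) \<le> C)"
      using \<open>d > 0\<close> by blast
  qed
  then obtain C where C: "\<And>t. 0 \<le> t \<Longrightarrow> t \<le> 2 * pi \<Longrightarrow> norm (power_resolvent b 0 t) \<le> C" by blast
  have "norm (power_resolvent b k t) \<le> max C 1" if "0 \<le> t" "t \<le> 2 * pi" for k t
    using that
  proof (induction k arbitrary: t)
    case 0 then show ?case using C[of t] by simp
  next
    case (Suc k)
    have "norm (power_resolvent b k (t/2)) \<le> max C 1" "norm (power_resolvent b k (t/2 + pi)) \<le> max C 1"
      using Suc.prems by (auto intro!: Suc.IH)
    then have "norm (power_resolvent b k (t/2) + power_resolvent b k (t/2 + pi)) \<le> 2 * max C 1"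
      using norm_triangle_ineq[of "power_resolvent b k (t/2)" "power_resolvent b k (t/2 + pi)"] by linarith
    then show ?case by (simp add: power_resolvent_average)
  qed
  then show thesis by (intro that[of "max C 1"]) auto
qed

text \<open>The case \<open>k = 0\<close> is the resolvent identity. Afterwards the constant is halved each time,
because the mean is taken at half angles, whose distances are half those of the angles.\<close>

lemma power_resolvent_Lipschitz:
  obtains L where "\<And>k s t. 0 \<le> s \<Longrightarrow> s \<le> 2 * pi \<Longrightarrow> 0 \<le> t \<Longrightarrow> t \<le> 2 * pi \<Longrightarrow>
    norm (power_resolvent b k s - power_resolvent b k t) \<le> L * (1/2) ^ k * \<bar>s - t\<bar>"
proof -
  obtain C where "C > 0" and C: "\<And>k t. 0 \<le> t \<Longrightarrow> t \<le> 2 * pi \<Longrightarrow> norm (power_resolvent b k t) \<le> C"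
    using power_resolvent_bounded by blast
  have "norm (power_resolvent b k s - power_resolvent b k t) \<le> (C * norm b * C) * (1/2) ^ k * \<bar>s - t\<bar>"
    if "0 \<le> s" "s \<le> 2 * pi" "0 \<le> t" "t \<le> 2 * pi" for k s t
    using that
  proof (induction k arbitrary: s t)
    case 0
    have "norm (power_resolvent b 0 s) * norm b * norm (power_resolvent b 0 t) \<le> C * norm b * C"
      using 0 \<open>C > 0\<close> by (intro mult_mono C) auto
    from mult_left_mono[OF this abs_ge_zero[of "s - t"]] show ?case
      using norm_power_resolvent_diff[of s t] by (simp add: mult.commute)
  next
    case (Suc k)
    let ?B = "(C * norm b * C) * (1/2) ^ k * (\<bar>s - t\<bar> / 2)"
    have "\<bar>s/2 - t/2\<bar> = \<bar>s - t\<bar> / 2"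
      by (auto simp: abs_if diff_divide_distrib)
    then have 1: "norm (power_resolvent b k (s/2) - power_resolvent b k (t/2)) \<le> ?B"
      using Suc.IH[of "s/2" "t/2"] Suc.prems by (simp only: \<open>\<bar>s/2 - t/2\<bar> = _\<close>)
    have "\<bar>(s/2 + pi) - (t/2 + pi)\<bar> = \<bar>s - t\<bar> / 2"
      by (auto simp: abs_if diff_divide_distrib)
    then have 2: "norm (power_resolvent b k (s/2 + pi) - power_resolvent b k (t/2 + pi)) \<le> ?B"
      using Suc.IH[of "s/2 + pi" "t/2 + pi"] Suc.prems
      by (simp only: \<open>\<bar>(s/2 + pi) - (t/2 + pi)\<bar> = _\<close>)
    have "power_resolvent b (Suc k) s - power_resolvent b (Suc k) t = (1/2) *\<^sub>R
        ((power_resolvent b k (s/2) - power_resolvent b k (t/2)) +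
          (power_resolvent b k (s/2 + pi) - power_resolvent b k (t/2 + pi)))"
      by (simp add: power_resolvent_average algebra_simps)
    also have "norm \<dots> \<le> (1/2) * (?B + ?B)"
      using norm_triangle_mono[OF 1 2] by simp
    finally show ?case by (simp add: mult_ac)
  qed
  then show thesis using that by blast
qed

text \<open>The difference of successive terms is half the difference of the values at \<open>pi\<close> and \<open>0\<close>, hence
of order \<open>2^(-k)\<close>. The limit is idempotent because the value at \<open>pi\<close> has the same limit as the
value at \<open>0\<close>, and their product is the next term.\<close>

lemma power_resolvent_converges:
  obtains q where "(\<lambda>k. power_resolvent b k 0) \<longlonglongrightarrow> q" "q * q = q"
proof -
  obtain L where L: "\<And>k s t. 0 \<le> s \<Longrightarrow> s \<le> 2 * pi \<Longrightarrow> 0 \<le> t \<Longrightarrow> t \<le> 2 * pi \<Longrightarrow>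
      norm (power_resolvent b k s - power_resolvent b k t) \<le> L * (1/2) ^ k * \<bar>s - t\<bar>"
    using power_resolvent_Lipschitz by blast
  define X where "X k = power_resolvent b k 0" for k
  have step: "X (Suc k) - X k = (1/2) *\<^sub>R (power_resolvent b k pi - power_resolvent b k 0)" for k
    by (simp add: X_def power_resolvent_average algebra_simps flip: scaleR_add_left)
  have step_le: "norm (X (Suc k) - X k) \<le> L * pi * (1/2) ^ k" for k
  proof -
    have "norm (X (Suc k) - X k) \<le> norm (power_resolvent b k pi - power_resolvent b k 0)"
      by (simp add: step)
    also have "\<dots> \<le> L * pi * (1/2) ^ k" using L[of pi 0 k] by (simp add: mult_ac)
    finally show ?thesis .
  qed
  have "summable (\<lambda>k. L * pi * (1/2) ^ k :: real)"
    by (intro summable_mult summable_geometric) simp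
  then have "summable (\<lambda>k. X (Suc k) - X k)"
    by (rule summable_comparison_test'[of _ 0]) (rule step_le)
  then have "convergent (\<lambda>n. \<Sum>k<n. X (Suc k) - X k)"
    by (simp add: summable_iff_convergent)
  then obtain l where "(\<lambda>n. X n - X 0) \<longlonglongrightarrow> l"
    unfolding convergent_def sum_lessThan_telescope ..
  from tendsto_add[OF this tendsto_const[of "X 0"]] have X: "X \<longlonglongrightarrow> l + X 0" by simp
  have prod: "X k * (2 *\<^sub>R X (Suc k) - X k) = X (Suc k)" for k
    using power_resolvent_mult[where k = k and t = 0] power_resolvent_average[where k = k and t = 0]
    by (simp add: X_def)
  have "(\<lambda>k. X k * (2 *\<^sub>R X (Suc k) - X k)) \<longlonglongrightarrow> (l + X 0) * (2 *\<^sub>R (l + X 0) - (l + X 0))"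
    by (intro tendsto_intros X LIMSEQ_Suc)
  then have "(l + X 0) * (2 *\<^sub>R (l + X 0) - (l + X 0)) = l + X 0"
    unfolding prod using LIMSEQ_Suc[OF X] by (rule LIMSEQ_unique)
  then have "(l + X 0) * (l + X 0) = l + X 0" by (simp add: scaleR_2)
  then show thesis using that X by (simp add: X_def[abs_def])
qed

end

section \<open>The spectral idempotent of an isolated point\<close>

text \<open>The limit \<open>q\<close> of \<open>x\<^sub>k = (1 - b^(2^k))\<^sup>-\<^sup>1\<close>, for \<open>b = a/r\<close> with \<open>0 < r < \<epsilon>\<close>, should be thought of as \<open>1\<close> on the part
of the spectrum inside the circle of radius \<open>r\<close>, where the powers of \<open>b\<close> tend to \<open>0\<close>, and as
\<open>0\<close> on the part outside. Accordingly, \<open>b^(2^k) x\<^sub>k = x\<^sub>k - 1\<close> tends to \<open>q - 1\<close>: it is bounded, so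
that \<open>b^(2^k) q\<close> is bounded and the spectral radius of \<open>a q\<close> is at most \<open>r\<close>; and it is close to \<open>-(1 - q)\<close>,
so that \<open>b\<close> has an inverse relative to the idempotent \<open>1 - q\<close>. For \<open>0 < \<bar>z\<bar> < \<epsilon>\<close> the element \<open>a q - z\<close> is invertible
because \<open>a - z\<close> is.\<close>

lemma isolated_spectral_idempotent:
  fixes a :: "'a::complex_banach_algebra"
  assumes "\<epsilon> > 0" and inv: "\<And>z. z \<noteq> 0 \<Longrightarrow> cmod z < \<epsilon> \<Longrightarrow> binvertible (a - z *\<^sub>C 1)"
  obtains q s where "q * q = q" "a * q = q * a"
    "\<And>z. z \<noteq> 0 \<Longrightarrow> binvertible (a * q - z *\<^sub>C 1)"
    "a * s = 1 - q" "s * a = 1 - q" "q * s = s * q"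
proof -
  define r where "r = \<epsilon> / 2"
  have r: "r > 0" "r < \<epsilon>" using \<open>\<epsilon> > 0\<close> by (auto simp: r_def)
  define b where "b = complex_of_real (1 / r) *\<^sub>C a"
  have ab: "a = complex_of_real r *\<^sub>C b" using r by (simp add: b_def scaleC_scaleC)
  have circle: "binvertible (1 - cis t *\<^sub>C b)" for t
  proof -
    let ?z = "complex_of_real r * cis (- t)"
    have "binvertible ((- cis t / r) *\<^sub>C (a - ?z *\<^sub>C 1))"
      using r by (intro binvertible_scaleC inv) (auto simp: norm_mult)
    also have "(- cis t / r) *\<^sub>C (a - ?z *\<^sub>C 1) = 1 - cis t *\<^sub>C b"
      using r by (simp add: scaleC_diff_right scaleC_scaleC b_def scaleC_minus_left cis_mult)
    finally show ?thesis .
  qed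
  define X where "X k = power_resolvent b k 0" for k
  obtain q where X: "X \<longlonglongrightarrow> q" and qq: "q * q = q"
    using power_resolvent_converges[OF circle] unfolding X_def[abs_def] by blast
  obtain C where C: "\<And>k. norm (X k) \<le> C"
    using power_resolvent_bounded[OF circle] unfolding X_def
    by (metis order_refl pi_ge_zero mult_nonneg_nonneg zero_le_numeral)
  have Xcomm: "y * X k = X k * y" if "y * b = b * y" for y k
    unfolding X_def using circle that by (rule power_resolvent_commute)
  have bX: "b * X k = X k * b" for k by (rule Xcomm) simp
  have qcomm: "y * q = q * y" if "y * b = b * y" for y
  proof (rule LIMSEQ_unique)
    show "(\<lambda>k. y * X k) \<longlonglongrightarrow> y * q" by (intro tendsto_intros X)
    show "(\<lambda>k. y * X k) \<longlonglongrightarrow> q * y" unfolding Xcomm[OF that] by (intro tendsto_intros X)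
  qed
  have bq: "b * q = q * b" by (rule qcomm) simp
  have powX: "b ^ (2 ^ k) * X k = X k - 1" for k
    using power_resolvent_right[OF circle, where k = k and t = 0] by (simp add: X_def algebra_simps)
  have qX: "q * X k = X k * q" for k using Xcomm bq by metis
  have bnq: "b ^ n * q = q * b ^ n" for n using bq by (metis power_commuting_commutes)
  \<comment> \<open>Split \<open>b^(2^k) q = b^(2^k) x\<^sub>k q + b^(2^k) q (q - x\<^sub>k)\<close>; once \<open>q - x\<^sub>k\<close> is small, the last summand can be
    absorbed on the left.\<close>
  obtain k0 where k0: "\<And>k. k \<ge> k0 \<Longrightarrow> norm (X k - q) < 1 / 2"
    using LIMSEQ_D[OF X, of "1/2"] by auto
  define K where "K = 2 * ((C + norm (1::'a)) * norm q)"
  have K: "norm (b ^ (2 ^ k) * q) \<le> K" if "k \<ge> k0" for k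
  proof -
    let ?p = "b ^ (2 ^ k)"
    have "?p * q = ?p * X k * q + (?p * q) * (q - X k)"
      by (simp add: algebra_simps qq qX)
    also have "norm \<dots> \<le> norm (X k - 1) * norm q + norm (?p * q) * norm (q - X k)"
      unfolding powX by (intro norm_triangle_mono norm_mult_ineq)
    also have "\<dots> \<le> (C + norm (1::'a)) * norm q + norm (?p * q) * (1 / 2)"
      using C[of k] k0[OF that] norm_triangle_ineq4[of "X k" 1]
      by (intro add_mono mult_right_mono mult_left_mono) (auto simp: norm_minus_commute)
    finally show ?thesis by (simp add: K_def)
  qed
  have quasi: "binvertible (a * q - z *\<^sub>C 1)" if "z \<noteq> 0" for z
  proof (cases "cmod z < \<epsilon>")
    case True
    have zi: "binvertible (a - z *\<^sub>C 1)" using inv that True by blast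
    define v where "v = binv (a - z *\<^sub>C 1)"
    have aq: "a * q = q * a" by (simp add: ab bq mult_scaleC_left mult_scaleC_right)
    have "q * (a - z *\<^sub>C 1) = (a - z *\<^sub>C 1) * q"
      by (simp add: algebra_simps aq mult_scaleC_left mult_scaleC_right)
    from binv_commute[OF zi this] have vq: "q * v = v * q" by (simp add: v_def)
    have v1: "a * v = 1 + z *\<^sub>C v" "v * a = 1 + z *\<^sub>C v"
      using binv[OF zi] by (simp_all add: v_def algebra_simps mult_scaleC_left mult_scaleC_right)
    \<comment> \<open>The element \<open>a q - z\<close> acts as \<open>a - z\<close> on the range of \<open>q\<close>, and as \<open>-z\<close> on its kernel.\<close>
    let ?w = "v * q - (1 / z) *\<^sub>C (1 - q)"
    have "(a * q) * (v * q) = a * v * q"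
      using vq qq by (metis mult.assoc)
    moreover have "(v * q) * (a * q) = v * a * q"
      using aq qq by (metis mult.assoc)
    moreover have "(a * q) * (1 - q) = 0" "(1 - q) * (a * q) = 0"
      using aq qq by (simp_all add: algebra_simps) (metis mult.assoc)+
    ultimately have "(a * q - z *\<^sub>C 1) * ?w = 1" "?w * (a * q - z *\<^sub>C 1) = 1"
      using that v1
      by (simp_all add: left_diff_distrib right_diff_distrib mult_scaleC_left mult_scaleC_right
          scaleC_scaleC scaleC_diff_right distrib_right)
    then show ?thesis by (rule binvertibleI)
  next
    case False
    define y where "y = (1 / z) *\<^sub>C (a * q)"
    define \<rho> where "\<rho> = r / cmod z"
    have \<rho>: "0 \<le> \<rho>" "\<rho> < 1" using False r by (auto simp: \<rho>_def divide_less_eq_1)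
    have y: "y = (r / z) *\<^sub>C (b * q)" by (simp add: y_def ab mult_scaleC_left scaleC_scaleC)
    have "(b * q) ^ Suc n = b ^ Suc n * q" for n
    proof (induction n)
      case (Suc n)
      have "(b * q) ^ Suc (Suc n) = b * q * (b ^ Suc n * q)" using Suc by simp
      also have "\<dots> = b * (b ^ Suc n * q) * q" using bnq[of "Suc n"] by (simp only: mult.assoc)
      also have "\<dots> = b ^ Suc (Suc n) * q" using qq by (simp add: mult.assoc)
      finally show ?case .
    qed simp
    then have powq: "(b * q) ^ (2 ^ k) = b ^ (2 ^ k) * q" for k
      by (metis gr0_conv_Suc zero_less_numeral zero_less_power)
    have "(\<lambda>n. \<rho> ^ n * K) \<longlonglongrightarrow> 0"
      using LIMSEQ_power_zero[of \<rho>] \<rho> by (intro tendsto_mult_left_zero) auto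
    then obtain n0 where n0: "\<And>n. n \<ge> n0 \<Longrightarrow> norm (\<rho> ^ n * K) < 1"
      using LIMSEQ_D[of _ 0 1] by fastforce
    define k where "k = max n0 k0"
    have "n0 \<le> k" by (simp add: k_def)
    then have "n0 \<le> 2 ^ k" using less_exp[of k] by linarith
    have "norm (y ^ (2 ^ k)) = \<rho> ^ (2 ^ k) * norm (b ^ (2 ^ k) * q)"
      using r by (simp add: y power_scaleC powq norm_scaleC norm_power norm_divide \<rho>_def)
    also have "\<dots> \<le> \<rho> ^ (2 ^ k) * K" using \<rho> by (intro mult_left_mono K) (auto simp: k_def)
    also have "\<dots> < 1" using n0[OF \<open>n0 \<le> 2 ^ k\<close>] by simp
    finally have "binvertible (1 - y)"
      by (intro binvertible_one_minus_if_power[of y k] binvertible_one_minus)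
    then have "binvertible ((- z) *\<^sub>C (1 - y))" using that by (intro binvertible_scaleC) auto
    also have "(- z) *\<^sub>C (1 - y) = a * q - z *\<^sub>C 1"
      using that by (simp add: y_def scaleC_diff_right scaleC_scaleC scaleC_minus_left)
    finally show ?thesis .
  qed
  define e where "e = 1 - q"
  have ee: "e * e = e" and eq: "e * q = q * e" and eb: "e * b = b * e"
    using qq bq by (simp_all add: e_def algebra_simps)
  have "(\<lambda>k. X k * e) \<longlonglongrightarrow> q * e" by (intro tendsto_intros X)
  moreover have "q * e = 0" using qq by (simp add: e_def algebra_simps)
  ultimately obtain k where k: "norm (X k * e) < 1"
    using LIMSEQ_D[of "\<lambda>k. X k * e" 0 1] by auto
  \<comment> \<open>As \<open>x\<^sub>k e\<close> tends to \<open>q e = 0\<close>, the element \<open>b^(2^k) x\<^sub>k e = -(e - u)\<close> is invertible relative to \<open>e\<close>.\<close>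
  define u where "u = X k * e"
  define w where "w = binv (1 - u)"
  have u1: "binvertible (1 - u)" unfolding u_def using k by (rule binvertible_one_minus)
  have ub: "b * u = u * b" using bX eb by (metis u_def mult.assoc)
  have uq: "q * u = u * q" using qX eq by (metis u_def mult.assoc)
  have wcomm: "y * w = w * y" if "y * u = u * y" for y
    unfolding w_def using that by (intro binv_commute u1) (simp add: algebra_simps)
  have eu: "e * u = u" using Xcomm[OF eb] ee by (metis u_def mult.assoc)
  have "e * (1 - u) * w = e" using binv_right[OF u1] by (simp add: w_def mult.assoc)
  then have ew: "(e - u) * w = e" using eu by (simp add: right_diff_distrib)
  obtain n where n: "2 ^ k = Suc n" by (metis gr0_conv_Suc zero_less_numeral zero_less_power)
  have "b ^ (2 ^ k) * u = u - e"
    using powX[of k] by (simp add: u_def left_diff_distrib flip: mult.assoc)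
  then have "b * (b ^ n * u) * w = - e"
    using ew by (simp add: n left_diff_distrib mult.assoc) (metis minus_diff_eq)
  define s where "s = (- 1 / r) *\<^sub>C (b ^ n * u * w)"
  have "b * (b ^ n * u * w) = - e" using \<open>b * (b ^ n * u) * w = - e\<close> by (simp add: mult.assoc)
  have bn: "b ^ n * u = u * b ^ n" using ub by (metis power_commuting_commutes)
  have "(b ^ n * u * w) * b = b * (b ^ n * u * w)"
    using ub wcomm[OF ub] power_commutes[of b n] by (metis mult.assoc)
  have "a * s = e"
    using r by (simp add: ab s_def mult_scaleC_left mult_scaleC_right scaleC_scaleC
        \<open>b * (b ^ n * u * w) = - e\<close> scaleC_minus_left scaleC_minus_right)
  moreover have "s * a = e"
    using r by (simp add: ab s_def mult_scaleC_left mult_scaleC_right scaleC_scaleC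
        \<open>(b ^ n * u * w) * b = b * (b ^ n * u * w)\<close> \<open>b * (b ^ n * u * w) = - e\<close> scaleC_minus_left scaleC_minus_right)
  moreover have "q * (b ^ n * u * w) = (b ^ n * u * w) * q"
    using bnq[of n] uq wcomm[OF uq] by (metis mult.assoc)
  then have "q * s = s * q" by (simp add: s_def mult_scaleC_left mult_scaleC_right)
  moreover have "a * q = q * a" by (simp add: ab bq mult_scaleC_left mult_scaleC_right)
  ultimately show thesis using qq quasi by (intro that[of q s]) (auto simp: e_def)
qed

section \<open>The Kato decomposition at an isolated point\<close>

text \<open>The operators from a space to itself, as a type of their own: only for these is composition a
binary operation, so only they can form an instance of the class of Banach algebras.\<close>

typedef (overloaded) 'a endo = "UNIV :: ('a::complex_banach \<Rightarrow>\<^sub>C\<^sub>L 'a) set"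
  morphisms op_of Endo ..

setup_lifting type_definition_endo

instantiation endo :: (complex_banach) complex_normed_vector
begin

lift_definition zero_endo :: "'a endo" is 0 .
lift_definition plus_endo :: "'a endo \<Rightarrow> 'a endo \<Rightarrow> 'a endo" is "(+)" .
lift_definition minus_endo :: "'a endo \<Rightarrow> 'a endo \<Rightarrow> 'a endo" is "(-)" .
lift_definition uminus_endo :: "'a endo \<Rightarrow> 'a endo" is uminus .
lift_definition scaleR_endo :: "real \<Rightarrow> 'a endo \<Rightarrow> 'a endo" is scaleR .
lift_definition scaleC_endo :: "complex \<Rightarrow> 'a endo \<Rightarrow> 'a endo" is scaleC .
lift_definition norm_endo :: "'a endo \<Rightarrow> real" is norm .
lift_definition dist_endo :: "'a endo \<Rightarrow> 'a endo \<Rightarrow> real" is dist .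

definition uniformity_endo_def:
  "(uniformity :: ('a endo \<times> 'a endo) filter) = (INF e\<in>{0 <..}. principal {(f, g). dist f g < e})"

definition open_endo :: "'a endo set \<Rightarrow> bool"
  where "open_endo S = (\<forall>f\<in>S. \<forall>\<^sub>F (f', g) in uniformity. f' = f \<longrightarrow> g \<in> S)"

definition sgn_endo :: "'a endo \<Rightarrow> 'a endo"
  where "sgn_endo f = scaleR (inverse (norm f)) f"

instance
proof
  fix f g h :: "'a endo" and a b :: complex and r s :: real
  show "f + g + h = f + (g + h)" "f + g = g + f" "0 + f = f" "- f + f = 0" "f - g = f + - g"
    by (transfer; simp)+
  show "r *\<^sub>R (f + g) = r *\<^sub>R f + r *\<^sub>R g" "(r + s) *\<^sub>R f = r *\<^sub>R f + s *\<^sub>R f"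
    "r *\<^sub>R s *\<^sub>R f = (r * s) *\<^sub>R f" "1 *\<^sub>R f = f"
    by (transfer; simp add: scaleR_add_right scaleR_add_left)+
  show "dist f g = norm (f - g)" by transfer (rule dist_norm)
  show "sgn f = inverse (norm f) *\<^sub>R f" by (simp add: sgn_endo_def)
  show "(uniformity :: ('a endo \<times> 'a endo) filter) = (INF e\<in>{0 <..}. principal {(f, g). dist f g < e})"
    by (simp add: uniformity_endo_def)
  show "open U = (\<forall>f\<in>U. \<forall>\<^sub>F (f', g) in uniformity. f' = f \<longrightarrow> g \<in> U)" for U :: "'a endo set"
    by (simp add: open_endo_def)
  show "(norm f = 0) = (f = 0)" by transfer simp
  show "norm (f + g) \<le> norm f + norm g" by transfer (rule norm_triangle_ineq)
  show "norm (r *\<^sub>R f) = \<bar>r\<bar> * norm f" by transfer simp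
  show "a *\<^sub>C (f + g) = a *\<^sub>C f + a *\<^sub>C g" by transfer (rule scaleC_add_right)
  show "(a + b) *\<^sub>C f = a *\<^sub>C f + b *\<^sub>C f" by transfer (rule scaleC_add_left)
  show "a *\<^sub>C b *\<^sub>C f = (a * b) *\<^sub>C f" by transfer (rule scaleC_scaleC)
  show "complex_of_real r *\<^sub>C f = r *\<^sub>R f" by transfer (rule scaleC_of_real)
  show "norm (a *\<^sub>C f) = cmod a * norm f" by transfer (rule norm_scaleC)
qed

end

instance endo :: (complex_banach) complex_banach
proof
  fix X :: "nat \<Rightarrow> 'a endo"
  assume "Cauchy X"
  then have "Cauchy (\<lambda>n. op_of (X n))" by (simp add: Cauchy_def dist_endo.rep_eq)
  then obtain L where "(\<lambda>n. op_of (X n)) \<longlonglongrightarrow> L" using Cauchy_convergent convergent_def by blast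
  then have "X \<longlonglongrightarrow> Endo L" by (simp add: lim_sequentially dist_endo.rep_eq Endo_inverse)
  then show "convergent X" by (auto simp: convergent_def)
qed

instantiation endo :: (complex_banach) complex_banach_algebra
begin

lift_definition one_endo :: "'a endo" is id_cblinfun .
lift_definition times_endo :: "'a endo \<Rightarrow> 'a endo \<Rightarrow> 'a endo" is cblinfun_compose .

instance
proof
  fix f g h :: "'a endo" and a :: complex and r :: real
  show "f * g * h = f * (g * h)" "1 * f = f" "f * 1 = f"
    by (transfer; auto intro!: cblinfun_eqI simp: capply_compose capply_id)+
  show "(f + g) * h = f * h + g * h" "f * (g + h) = f * g + f * h"
    by (transfer; auto intro!: cblinfun_eqI simp: capply_compose capply_plus linear_simps(1)[OF bounded_linear_capply])+
  show "(a *\<^sub>C f) * g = a *\<^sub>C (f * g)" "f * (a *\<^sub>C g) = a *\<^sub>C (f * g)"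
    by (transfer; auto intro!: cblinfun_eqI simp: capply_compose capply_cblinfun_scaleC capply_scaleC)+
  show "(r *\<^sub>R f) * g = r *\<^sub>R (f * g)" "f * (r *\<^sub>R g) = r *\<^sub>R (f * g)"
    by (transfer; auto intro!: cblinfun_eqI simp: capply_compose capply_cblinfun_scaleC capply_scaleC
        simp flip: scaleC_of_real)+
  show "norm (f * g) \<le> norm f * norm g"
  proof (transfer, rule norm_cblinfun_le)
    show "norm (capply (f o\<^sub>C\<^sub>L g) x) \<le> norm f * norm g * norm x" for f g :: "'a \<Rightarrow>\<^sub>C\<^sub>L 'a" and x
      unfolding capply_compose mult.assoc
      by (intro order_trans[OF norm_capply] mult_left_mono norm_capply norm_ge_zero)
  qed simp
qed

end

lemma binvertible_Endo: "binvertible (Endo A) \<longleftrightarrow> cinvertible A"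
proof -
  have "binvertible a \<longleftrightarrow> cinvertible (op_of a)" for a :: "'a endo"
    unfolding binvertible_def cinvertible_def by transfer blast
  from this[of "Endo A"] show ?thesis by (simp add: Endo_inverse)
qed

lemma capply_op_of:
  "capply (op_of (a * b)) x = capply (op_of a) (capply (op_of b) x)"
  "capply (op_of (a + b)) x = capply (op_of a) x + capply (op_of b) x"
  "capply (op_of (a - b)) x = capply (op_of a) x - capply (op_of b) x"
  "capply (op_of (z *\<^sub>C a)) x = z *\<^sub>C capply (op_of a) x"
  "capply (op_of 1) x = x"
  by (simp_all add: times_endo.rep_eq plus_endo.rep_eq minus_endo.rep_eq scaleC_endo.rep_eq
      one_endo.rep_eq capply_compose capply_plus capply_minus capply_cblinfun_scaleC capply_id)

lemma capply_zero: "capply 0 x = 0"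
  by (simp add: zero_cblinfun.rep_eq capply.rep_eq)

lemmas capply_linear = linear_simps(1-4)[OF bounded_linear_capply]

lemma closed_csubspace_kernel: "closed_csubspace {x. capply A x = 0}"
  unfolding closed_csubspace_iff csubspace_def
  by (auto simp: capply_linear capply_scaleC
      intro!: closed_Collect_eq bounded_linear.continuous_on[OF bounded_linear_capply] continuous_intros)

text \<open>The decomposition consists of the kernel \<open>M\<close> and the range \<open>N\<close> of the spectral idempotent. On \<open>M\<close> the
operator is even bijective.\<close>

lemma pseudo_Fredholm_if_isolated:
  fixes A :: "'a::complex_banach \<Rightarrow>\<^sub>C\<^sub>L 'a"
  assumes "\<epsilon> > 0" and inv: "\<And>z. z \<noteq> 0 \<Longrightarrow> cmod z < \<epsilon> \<Longrightarrow> cinvertible (shift A z)"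
  shows "pseudo_Fredholm A"
proof -
  have shift_Endo: "Endo A - z *\<^sub>C 1 = Endo (shift A z)" for z
    by (simp add: op_of_inject[symmetric] minus_endo.rep_eq scaleC_endo.rep_eq one_endo.rep_eq Endo_inverse)
  obtain q s where qs: "q * q = q" "Endo A * q = q * Endo A"
    "\<And>z. z \<noteq> 0 \<Longrightarrow> binvertible (Endo A * q - z *\<^sub>C 1)"
    "Endo A * s = 1 - q" "s * Endo A = 1 - q" "q * s = s * q"
    using isolated_spectral_idempotent[OF \<open>\<epsilon> > 0\<close>, of "Endo A"] inv
    by (metis shift_Endo binvertible_Endo)
  define Q where "Q = op_of q"
  have pt: "capply (op_of a) x = capply (op_of b) x" if "a = b" for a b :: "'a endo" and x
    using that by simp
  have QQ: "capply Q (capply Q x) = capply Q x"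
    and AQ: "capply A (capply Q x) = capply Q (capply A x)"
    and AS: "capply A (capply (op_of s) x) = x - capply Q x"
    and SA: "capply (op_of s) (capply A x) = x - capply Q x"
    and QS: "capply Q (capply (op_of s) x) = capply (op_of s) (capply Q x)" for x
    using pt[OF qs(1), of x] pt[OF qs(2), of x] pt[OF qs(4), of x] pt[OF qs(5), of x] pt[OF qs(6), of x]
    by (simp_all add: capply_op_of Q_def Endo_inverse)
  define M where "M = {x. capply Q x = 0}"
  define N where "N = {x. capply Q x = x}"
  have N_eq: "N = {x. capply (Q - id_cblinfun) x = 0}"
    by (auto simp: N_def capply_minus capply_id)
  show ?thesis unfolding pseudo_Fredholm_def
  proof (rule exI[of _ M], rule exI[of _ N], intro conjI)
    show "closed_csubspace M" "closed_csubspace N"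
      unfolding M_def N_eq by (rule closed_csubspace_kernel)+
    show "capply A ` M \<subseteq> M" "capply A ` N \<subseteq> N"
      by (auto simp: M_def N_def AQ[symmetric] capply_linear)
    show "M \<inter> N = {0}" by (auto simp: M_def N_def capply_linear)
    show "{x + y |x y. x \<in> M \<and> y \<in> N} = UNIV"
    proof -
      have "\<exists>u v. x = u + v \<and> u \<in> M \<and> v \<in> N" for x
        by (rule exI[of _ "x - capply Q x"], rule exI[of _ "capply Q x"])
          (auto simp: M_def N_def capply_linear QQ)
      then show ?thesis by blast
    qed
    have S: "capply (op_of s) x \<in> M" "capply A (capply (op_of s) x) = x" "capply (op_of s) (capply A x) = x"
      if "x \<in> M" for x
      using that by (auto simp: M_def QS AS SA capply_linear)
    show "semi_regular_on M A" unfolding semi_regular_on_def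
    proof (intro conjI subsetI)
      have "capply A ` M = M" using S \<open>capply A ` M \<subseteq> M\<close> by (force simp: image_iff)
      then show "closed (capply A ` M)"
        using \<open>closed_csubspace M\<close> by (simp add: closed_csubspace_def)
      fix x assume "x \<in> {x \<in> M. capply A x = 0}"
      then have "x = 0" using S(3)[of x] by (simp add: capply_linear)
      have zero: "(capply A ^^ n) 0 = 0" for n by (induction n) (auto simp: capply_linear)
      have "0 \<in> (capply A ^^ n) ` M" for n
        using zero[of n] by (intro image_eqI[of _ _ 0]) (auto simp: M_def capply_linear)
      then show "x \<in> (\<Inter>n. (capply A ^^ n) ` M)" using \<open>x = 0\<close> by simp
    qed
    show "quasinilpotent_on N A" unfolding quasinilpotent_on_def
    proof
      fix z
      assume z: "z \<in> spectrum_on N A"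
      show "z \<in> {0}"
      proof (rule ccontr)
        assume "z \<notin> {0}"
        then have "z \<noteq> 0" by simp
        define d where "d = Endo A * q - z *\<^sub>C 1"
        define v where "v = binv d"
        have d: "binvertible d" unfolding d_def by (rule qs) fact
        have "q * d = d * q"
          by (simp add: d_def algebra_simps mult_scaleC_left mult_scaleC_right)
            (metis qs(1,2) mult.assoc)
        from binv_commute[OF d this] have qv: "q * v = v * q" by (simp add: v_def)
        have QV: "capply Q (capply (op_of v) x) = capply (op_of v) (capply Q x)" for x
          using pt[OF qv, of x] by (simp add: capply_op_of Q_def)
        have D: "capply (op_of d) x = capply (shift A z) x" if "x \<in> N" for x
          using that by (simp add: d_def capply_op_of Endo_inverse N_def Q_def capply_minus
              capply_cblinfun_scaleC capply_id)
        have V: "capply (op_of v) x \<in> N" "capply (op_of v) (capply (op_of d) x) = x"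
          "capply (op_of d) (capply (op_of v) x) = x" if "x \<in> N" for x
          using that pt[OF binv_left[OF d], of x] pt[OF binv_right[OF d], of x] QV[of x]
          by (auto simp: N_def v_def capply_op_of)
        have "\<exists>S K. \<forall>x\<in>N. S x \<in> N \<and> norm (S x) \<le> K * norm x \<and>
            S (capply (shift A z) x) = x \<and> capply (shift A z) (S x) = x"
        proof (rule exI[of _ "capply (op_of v)"], rule exI[of _ "norm (op_of v)"], intro ballI conjI)
          fix x assume "x \<in> N"
          show "norm (capply (op_of v) x) \<le> norm (op_of v) * norm x" by (rule norm_capply)
        qed (simp_all add: V flip: D)
        then show False using z unfolding spectrum_on_def by blast
      qed
    qed
  qed
qed

section \<open>Power series of eigenvectors\<close>

text \<open>Half the guaranteed radius of convergence suffices here, and there the derived series is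
dominated by \<open>B C \<Sum>\<^sub>n n (1/2)^(n - 1)\<close>.\<close>

lemma power_series_vector:
  fixes x :: "nat \<Rightarrow> 'b::complex_banach"
  assumes "C > 0" and bound: "\<And>n. norm (x n) \<le> B * C ^ n"
  obtains f d where "\<And>w. w \<in> ball 0 (1 / (2 * C)) \<Longrightarrow> (\<lambda>n. w ^ n *\<^sub>C x n) sums f w"
    "\<And>w. w \<in> ball 0 (1 / (2 * C)) \<Longrightarrow> (f has_derivative (\<lambda>h. h *\<^sub>C d w)) (at w)"
proof -
  define S where "S = ball (0::complex) (1 / (2 * C))"
  define t where "t n w = (of_nat n * w ^ (n - 1)) *\<^sub>C x n" for n and w :: complex
  define d where "d w = (\<Sum>n. t n w)" for w
  have "0 \<le> B" using order_trans[OF norm_ge_zero bound[of 0]] by simp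
  have left: "bounded_linear (\<lambda>c. c *\<^sub>C y)" for y :: 'b
    by (rule bounded_linear_intro[where K = "norm y"])
      (auto simp: scaleC_add_left norm_scaleC scaleC_scaleC scaleR_conv_of_real simp flip: scaleC_of_real)
  have t_le: "norm (t n w) \<le> (B * C) * (of_nat n * (1/2) ^ (n - 1))" if "w \<in> S" for n w
  proof (cases n)
    case (Suc m)
    have "cmod w \<le> 1 / (2 * C)" using that by (simp add: S_def)
    then have "cmod w ^ m * C ^ m \<le> (1 / (2 * C)) ^ m * C ^ m"
      using \<open>C > 0\<close> by (intro mult_right_mono power_mono) auto
    also have "\<dots> = (1/2) ^ m" using \<open>C > 0\<close> by (simp flip: power_mult_distrib)
    finally have *: "cmod w ^ m * C ^ m \<le> (1/2) ^ m" .
    have "norm (t n w) = of_nat n * cmod w ^ m * norm (x n)"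
      by (simp add: t_def norm_scaleC norm_mult norm_power Suc del: of_nat_Suc)
    also have "\<dots> \<le> of_nat n * cmod w ^ m * (B * C ^ n)"
      by (intro mult_left_mono bound) auto
    also have "\<dots> = (B * C * of_nat n) * (cmod w ^ m * C ^ m)" by (simp add: Suc)
    also have "\<dots> \<le> (B * C * of_nat n) * (1/2) ^ m"
      using * \<open>0 \<le> B\<close> \<open>C > 0\<close> by (intro mult_left_mono) auto
    finally show ?thesis by (simp add: Suc)
  qed (simp add: t_def)
  have "summable (\<lambda>n. of_nat (Suc n) * (1/2) ^ n :: real)"
    by (rule sums_summable[OF geometric_deriv_sums]) simp
  then have "summable (\<lambda>n. of_nat n * (1/2) ^ (n - 1) :: real)"
    by (subst summable_Suc_iff[symmetric]) simp
  then have unif: "uniform_limit S (\<lambda>n w. \<Sum>i<n. t i w) d sequentially"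
    unfolding d_def by (intro Weierstrass_m_test[OF t_le] summable_mult)
  have "\<exists>f. \<forall>w\<in>S. (\<lambda>n. w ^ n *\<^sub>C x n) sums (f w) \<and> (f has_derivative (\<lambda>h. h *\<^sub>C d w)) (at w within S)"
  proof (rule has_derivative_series[where f' = "\<lambda>n w h. h *\<^sub>C t n w" and x = 0 and l = "x 0"])
    show "convex S" "0 \<in> S" using \<open>C > 0\<close> by (auto simp: S_def)
    show "((\<lambda>w. w ^ n *\<^sub>C x n) has_derivative (\<lambda>h. h *\<^sub>C t n w)) (at w within S)" for n w
    proof -
      have "((\<lambda>w. w ^ n) has_derivative (\<lambda>h. (of_nat n * w ^ (n - 1)) * h)) (at w within S)"
        by (rule has_field_derivative_imp_has_derivative)
          (auto intro!: derivative_eq_intros)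
      from bounded_linear.has_derivative[OF left this, of "x n"] show ?thesis
        by (simp add: t_def scaleC_scaleC mult.commute)
    qed
    show "(\<lambda>n. 0 ^ n *\<^sub>C x n) sums x 0"
    proof -
      have "(\<lambda>n. 0 ^ n *\<^sub>C x n) = (\<lambda>n. if n = 0 then x n else 0)"
        by (auto simp: fun_eq_iff power_0_left)
      then show ?thesis using sums_single[of 0 x] by simp
    qed
    fix e :: real assume "e > 0"
    have "\<forall>\<^sub>F n in sequentially. \<forall>w\<in>S. dist (\<Sum>i<n. t i w) (d w) < e"
      using uniform_limitD[OF unif \<open>e > 0\<close>] .
    then show "\<forall>\<^sub>F n in sequentially. \<forall>w\<in>S. \<forall>h. norm ((\<Sum>i<n. h *\<^sub>C t i w) - h *\<^sub>C d w) \<le> e * norm h"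
    proof (eventually_elim, intro ballI allI)
      fix n w h assume *: "\<forall>w\<in>S. dist (\<Sum>i<n. t i w) (d w) < e" and "w \<in> S"
      have "(\<Sum>i<n. h *\<^sub>C t i w) - h *\<^sub>C d w = h *\<^sub>C ((\<Sum>i<n. t i w) - d w)"
        by (simp add: scaleC_diff_right linear_sum[OF bounded_linear.linear[OF bounded_linear_scaleC_right]])
      then show "norm ((\<Sum>i<n. h *\<^sub>C t i w) - h *\<^sub>C d w) \<le> e * norm h"
        using * \<open>w \<in> S\<close> by (simp add: norm_scaleC dist_norm mult.commute[of e] mult_left_mono less_imp_le)
    qed
  qed
  then obtain f where "\<forall>w\<in>S. (\<lambda>n. w ^ n *\<^sub>C x n) sums (f w) \<and> (f has_derivative (\<lambda>h. h *\<^sub>C d w)) (at w within S)"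
    by blast
  then show thesis
    by (intro that[of f d]) (auto simp: S_def at_within_open[OF _ open_ball])
qed

text \<open>With \<open>w = z - l\<close>, the shift by one step turns \<open>\<Sum>\<^sub>n w^n x\<^sub>n\<close> into
\<open>(T - l I) (\<Sum>\<^sub>n w^n x\<^sub>n) = \<Sum>\<^sub>n w^(n+1) x\<^sub>n = w \<Sum>\<^sub>n w^n x\<^sub>n\<close>. So the sum is an analytic family of eigenvectors,
with the value \<open>x\<^sub>0 \<noteq> 0\<close> at \<open>l\<close>.\<close>

lemma no_SVEP_if_backward_orbit:
  fixes T :: "'b::complex_banach \<Rightarrow>\<^sub>C\<^sub>L 'b" and x :: "nat \<Rightarrow> 'b"
  assumes "x 0 \<noteq> 0" and x0: "capply (shift T l) (x 0) = 0"
    and step: "\<And>n. capply (shift T l) (x (Suc n)) = x n"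
    and "C > 0" and bound: "\<And>n. norm (x (Suc n)) \<le> C * norm (x n)"
  shows "\<not> SVEP_at T l"
proof
  assume svep: "SVEP_at T l"
  define \<rho> where "\<rho> = 1 / (2 * C)"
  have "norm (x n) \<le> norm (x 0) * C ^ n" for n
  proof (induction n)
    case (Suc n)
    show ?case using order_trans[OF bound mult_left_mono[OF Suc, of C]] \<open>C > 0\<close>
      by (simp add: mult.left_commute)
  qed simp
  from power_series_vector[OF \<open>C > 0\<close> this] obtain f d where
    f: "\<And>w. w \<in> ball 0 \<rho> \<Longrightarrow> (\<lambda>n. w ^ n *\<^sub>C x n) sums f w"
    and d: "\<And>w. w \<in> ball 0 \<rho> \<Longrightarrow> (f has_derivative (\<lambda>h. h *\<^sub>C d w)) (at w)"
    unfolding \<rho>_def by blast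
  have "\<rho> > 0" using \<open>C > 0\<close> by (simp add: \<rho>_def)
  have mem: "z - l \<in> ball 0 \<rho>" if "z \<in> ball l \<rho>" for z
    using that by (simp add: dist_norm norm_minus_commute)
  have analytic: "(\<lambda>z. f (z - l)) vanalytic_on ball l \<rho>"
    unfolding vanalytic_on_def
  proof (intro ballI exI)
    fix z assume "z \<in> ball l \<rho>"
    have "((\<lambda>z. z - l) has_derivative (\<lambda>h. h)) (at z)"
      by (auto intro!: derivative_eq_intros)
    from has_derivative_compose[OF this d[OF mem]] \<open>z \<in> ball l \<rho>\<close>
    show "((\<lambda>z. f (z - l)) has_derivative (\<lambda>h. h *\<^sub>C d (z - l))) (at z)" by simp
  qed
  have eigen: "capply (shift T z) (f (z - l)) = 0" if "z \<in> ball l \<rho>" for z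
  proof -
    let ?w = "z - l" and ?A = "shift T l"
    note fw = f[OF mem[OF that]]
    have "(\<lambda>n. ?w ^ n *\<^sub>C capply ?A (x n)) sums capply ?A (f ?w)"
      using bounded_linear.sums[OF bounded_linear_capply fw] by (simp add: capply_scaleC)
    then have "(\<lambda>n. ?w ^ Suc n *\<^sub>C x n) sums capply ?A (f ?w)"
      using sums_Suc_iff[of "\<lambda>n. ?w ^ n *\<^sub>C capply ?A (x n)"] by (simp add: step x0)
    moreover have "(\<lambda>n. ?w ^ Suc n *\<^sub>C x n) sums (?w *\<^sub>C f ?w)"
      using bounded_linear.sums[OF bounded_linear_scaleC_right fw, of ?w] by (simp add: scaleC_scaleC)
    ultimately have "capply ?A (f ?w) = ?w *\<^sub>C f ?w" by (rule sums_unique2)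
    then show ?thesis
      by (simp add: capply_minus capply_cblinfun_scaleC capply_id scaleC_diff_left)
  qed
  have "f (l - l) = 0"
  proof (rule svep[unfolded SVEP_at_def, rule_format, of "ball l \<rho>" "\<lambda>z. f (z - l)" l])
    show "open (ball l \<rho>) \<and> connected (ball l \<rho>) \<and> l \<in> ball l \<rho> \<and>
        (\<lambda>z. f (z - l)) vanalytic_on ball l \<rho> \<and>
        (\<forall>z\<in>ball l \<rho>. capply (shift T z) (f (z - l)) = 0)"
      using \<open>\<rho> > 0\<close> by (intro conjI ballI analytic eigen) simp_all
  qed (use \<open>\<rho> > 0\<close> in simp)
  moreover have "f 0 = x 0"
  proof (rule sums_unique2)
    show "(\<lambda>n. 0 ^ n *\<^sub>C x n) sums f 0" using f[of 0] \<open>\<rho> > 0\<close> by simp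
    have "(\<lambda>n. 0 ^ n *\<^sub>C x n) = (\<lambda>n. if n = 0 then x n else 0)"
      by (auto simp: fun_eq_iff power_0_left)
    then show "(\<lambda>n. 0 ^ n *\<^sub>C x n) sums x 0" using sums_single[of 0 x] by simp
  qed
  ultimately show False using \<open>x 0 \<noteq> 0\<close> by simp
qed

lemma no_SVEP_if_bounded_preimages:
  fixes T :: "'b::complex_banach \<Rightarrow>\<^sub>C\<^sub>L 'b"
  assumes "v \<in> D" "v \<noteq> 0" "capply (shift T l) v = 0"
    and pre: "\<And>x. x \<in> D \<Longrightarrow> \<exists>y\<in>D. capply (shift T l) y = x \<and> norm y \<le> C * norm x"
  shows "\<not> SVEP_at T l"
proof -
  obtain h where h: "\<And>x. x \<in> D \<Longrightarrow> h x \<in> D" "\<And>x. x \<in> D \<Longrightarrow> capply (shift T l) (h x) = x"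
      "\<And>x. x \<in> D \<Longrightarrow> norm (h x) \<le> C * norm x"
    using pre by metis
  define x where "x n = (h ^^ n) v" for n
  have xD: "x n \<in> D" for n using h(1) assms(1) by (induction n) (auto simp: x_def)
  have xS: "x (Suc n) = h (x n)" for n by (simp add: x_def)
  have "norm (x (Suc n)) \<le> max C 1 * norm (x n)" for n
    unfolding xS using h(3)[OF xD, of n] by (rule order_trans) (intro mult_right_mono; simp)
  then show ?thesis
    using assms(2,3) h(2)[OF xD]
    by (intro no_SVEP_if_backward_orbit[of x _ _ "max C 1"]) (auto simp: x_def[of 0] xS)
qed

text \<open>A solution \<open>f\<close> vanishes on a punctured disc around \<open>l\<close>. If it had a nonzero value, a functional would
detect it, contradicting the identity theorem for scalar functions.\<close>

lemma SVEP_if_punctured_injective: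
  fixes T :: "'b::complex_normed_vector \<Rightarrow>\<^sub>C\<^sub>L 'b"
  assumes "\<epsilon> > 0" and inj: "\<And>z v. z \<noteq> l \<Longrightarrow> dist l z < \<epsilon> \<Longrightarrow> capply (shift T z) v = 0 \<Longrightarrow> v = 0"
  shows "SVEP_at T l"
  unfolding SVEP_at_def
proof (intro allI impI ballI, elim conjE)
  fix U f z
  assume U: "open U" "connected U" "l \<in> U" and f: "f vanalytic_on U"
    and eq: "\<forall>z\<in>U. capply (shift T z) (f z) = 0" and "z \<in> U"
  show "f z = 0"
  proof (rule ccontr)
    assume "f z \<noteq> 0"
    then obtain \<phi> :: "'b cdual" where \<phi>: "capply \<phi> (f z) = 1"
      using functional_separates[of "{0}" "f z"] by (auto simp: csubspace_def)
    have "capply \<phi> (f z) = 0"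
    proof (rule analytic_continuation[of "\<lambda>w. capply \<phi> (f w)" U "U \<inter> ball l \<epsilon> - {l}" l])
      show "(\<lambda>w. capply \<phi> (f w)) holomorphic_on U"
        unfolding holomorphic_on_def
      proof (intro ballI)
        fix w assume "w \<in> U"
        then obtain d where "(f has_derivative (\<lambda>h. h *\<^sub>C d)) (at w)"
          using f unfolding vanalytic_on_def by blast
        from bounded_linear.has_derivative[OF bounded_linear_capply this, of \<phi>]
        have "((\<lambda>w. capply \<phi> (f w)) has_derivative (\<lambda>h. capply \<phi> d * h)) (at w)"
          by (simp add: capply_scaleC scaleC_complex_def mult.commute)
        then have "((\<lambda>w. capply \<phi> (f w)) has_field_derivative capply \<phi> d) (at w)"
          by (simp add: has_field_derivative_def)
        then show "(\<lambda>w. capply \<phi> (f w)) field_differentiable (at w within U)"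
          using field_differentiable_at_within field_differentiable_def by blast
      qed
      have "l islimpt U \<inter> ball l \<epsilon>"
        using U \<open>\<epsilon> > 0\<close> by (intro interior_limit_point) (auto simp: interior_open)
      then show "l islimpt U \<inter> ball l \<epsilon> - {l}"
        by (rule islimpt_punctured[THEN iffD1])
      show "capply \<phi> (f w) = 0" if "w \<in> U \<inter> ball l \<epsilon> - {l}" for w
        using inj[of w "f w"] eq that by (simp add: linear_simps(3)[OF bounded_linear_capply])
    qed (use U \<open>z \<in> U\<close> in auto)
    then show False using \<phi> by simp
  qed
qed

section \<open>Bijectivity on the semi-regular part\<close>

text \<open>Let \<open>D\<close> be the intersection of the ranges of the powers of \<open>A\<close> on \<open>M\<close>. If \<open>y\<close> is in \<open>M\<close> and
\<open>A y\<close> is in \<open>D\<close>, then \<open>y\<close> is in \<open>D\<close>: for each \<open>n\<close> one has \<open>A y = A u\<close> with \<open>u\<close> in the range of the \<open>n\<close>-th power, and \<open>y - u\<close> is in the kernel, which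
semi-regularity places in that range as well. So preimages of points of \<open>D\<close> of comparable norm
lie in \<open>D\<close>, and a kernel vector, being in \<open>D\<close>, starts a backward orbit.\<close>

lemma semi_regular_SVEP_injective:
  fixes T :: "'a::complex_banach \<Rightarrow>\<^sub>C\<^sub>L 'a" and l :: complex
  defines "A \<equiv> shift T l"
  assumes M: "closed_csubspace M" and inv: "capply A ` M \<subseteq> M"
    and sr: "semi_regular_on M A" and svep: "SVEP_at T l"
    and v: "v \<in> M" "capply A v = 0"
  shows "v = 0"
proof (rule ccontr)
  assume "v \<noteq> 0"
  note M' = M[unfolded closed_csubspace_iff]
  have Ms: "subspace M" using M' csubspace_imp_subspace by blast
  have ker: "x \<in> (capply A ^^ n) ` M" if "x \<in> M" "capply A x = 0" for x n
    using sr that unfolding semi_regular_on_def by blast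
  have clo: "closed (capply A ` M)" using sr unfolding semi_regular_on_def by blast
  obtain C where C: "\<And>y. y \<in> capply A ` M \<Longrightarrow> \<exists>x\<in>M. capply A x = y \<and> norm x \<le> C * norm y"
    using bounded_preimages[OF bounded_linear_capply _ Ms clo] M' by blast
  have lin: "linear (capply A ^^ n)" for n
    by (induction n) (auto intro: linear_compose[unfolded o_def] bounded_linear.linear[OF bounded_linear_capply]
        linear_ident simp: id_def o_def)
  have stay: "(capply A ^^ n) x \<in> M" if "x \<in> M" for n x
    using that inv by (induction n) auto
  define D where "D = (\<Inter>n. (capply A ^^ n) ` M)"
  have "\<exists>y\<in>D. capply A y = x \<and> norm y \<le> C * norm x" if "x \<in> D" for x
  proof -
    have "x \<in> (capply A ^^ 1) ` M" using that unfolding D_def by blast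
    then obtain y where y: "y \<in> M" "capply A y = x" "norm y \<le> C * norm x"
      using C by auto
    have "y \<in> (capply A ^^ n) ` M" for n
    proof -
      have "x \<in> (capply A ^^ Suc n) ` M" using that unfolding D_def by blast
      then obtain m where m: "m \<in> M" "x = capply A ((capply A ^^ n) m)" by auto
      let ?u = "(capply A ^^ n) m"
      have "y - ?u \<in> (capply A ^^ n) ` M"
        using y m stay Ms by (intro ker) (auto simp: capply_linear subspace_diff)
      then have "?u + (y - ?u) \<in> (capply A ^^ n) ` M"
        using m(1) by (intro subspace_add linear_subspace_image lin Ms) auto
      then show ?thesis by simp
    qed
    then show ?thesis using y unfolding D_def by blast
  qed
  moreover have "v \<in> D" unfolding D_def using ker v by blast
  ultimately have "\<not> SVEP_at T l"
    using \<open>v \<noteq> 0\<close> v(2) unfolding A_def by (intro no_SVEP_if_bounded_preimages[of v D]) auto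
  then show False using svep by contradiction
qed

lemma shift_cadjoint: "shift (cadjoint T) l = cadjoint (shift T l)"
  by (intro cblinfun_eqI) (simp add: capply_minus capply_cblinfun_scaleC capply_id capply_cadjoint
      capply_compose capply_linear capply_scaleC)

text \<open>The dual counterpart: let \<open>D\<close> consist of the functionals that annihilate \<open>N\<close>. If \<open>A M \<noteq> M\<close>, then \<open>D\<close> contains a
nonzero functional that annihilates \<open>A M\<close> and hence belongs to the kernel of the adjoint. Every
\<open>\<phi>\<close> in \<open>D\<close> is the image of some \<open>\<psi>\<close> in \<open>D\<close> of comparable norm: as \<open>A\<close> is bounded below on \<open>M\<close>, the
condition \<open>\<psi> (A m) = \<phi> m\<close> defines a bounded functional on \<open>A M\<close>, which is extended by the Hahn-Banach
theorem and then composed with the projection onto \<open>M\<close> along \<open>N\<close>.\<close>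

lemma adjoint_SVEP_surjective:
  fixes T :: "'a::complex_banach \<Rightarrow>\<^sub>C\<^sub>L 'a" and l :: complex
  defines "A \<equiv> shift T l"
  assumes M: "closed_csubspace M" and N: "closed_csubspace N"
    and inv: "capply A ` M \<subseteq> M" "capply A ` N \<subseteq> N"
    and sum: "M \<inter> N = {0}" "{x + y |x y. x \<in> M \<and> y \<in> N} = UNIV"
    and clo: "closed (capply A ` M)" and inj: "\<And>x. x \<in> M \<Longrightarrow> capply A x = 0 \<Longrightarrow> x = 0"
    and svep: "SVEP_at (cadjoint T) l"
  shows "capply A ` M = M"
proof (rule ccontr)
  assume "capply A ` M \<noteq> M"
  then obtain x where x: "x \<in> M" "x \<notin> capply A ` M" using inv by blast
  note M' = M[unfolded closed_csubspace_iff] and N' = N[unfolded closed_csubspace_iff]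
  have Ms: "subspace M" and Mc: "csubspace M" using M' csubspace_imp_subspace by blast+
  obtain P where P: "\<And>x. capply P x \<in> M" "\<And>x. x - capply P x \<in> N"
    "\<And>x. x \<in> M \<Longrightarrow> capply P x = x" "\<And>x. x \<in> N \<Longrightarrow> capply P x = 0"
    using bounded_projection[OF M N sum] by blast
  have PA: "capply P (capply A x) = capply A (capply P x)" for x
  proof -
    have "capply A x = capply A (capply P x) + capply A (x - capply P x)"
      by (simp flip: capply_linear)
    moreover have "capply A (capply P x) \<in> M" "capply A (x - capply P x) \<in> N"
      using P(1,2) inv by blast+
    ultimately show ?thesis using P(3,4) by (simp add: capply_linear(1))
  qed
  define R where "R = capply A ` M"
  have Rc: "csubspace R"
    unfolding csubspace_def R_def
  proof (intro conjI ballI allI)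
    show "0 \<in> capply A ` M" using csubspaceD(1)[OF Mc] by (intro image_eqI[of _ _ 0]) (auto simp: capply_linear)
    show "u + v \<in> capply A ` M" if "u \<in> capply A ` M" "v \<in> capply A ` M" for u v
      using that csubspaceD(2)[OF Mc] by (auto simp flip: capply_linear(1))
    show "c *\<^sub>C u \<in> capply A ` M" if "u \<in> capply A ` M" for c u
      using that csubspaceD(3)[OF Mc] by (auto simp flip: capply_scaleC)
  qed
  obtain C where "C > 0" and C: "\<And>y. y \<in> R \<Longrightarrow> \<exists>x\<in>M. capply A x = y \<and> norm x \<le> C * norm y"
    using bounded_preimages[OF bounded_linear_capply _ Ms clo] M' unfolding R_def by blast
  have uniq: "x = y" if "x \<in> M" "y \<in> M" "capply A x = capply A y" for x y
    using inj[of "x - y"] that Ms by (simp add: subspace_diff capply_linear)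
  define D where "D = {\<phi> :: 'a cdual. \<forall>x\<in>N. capply \<phi> x = 0}"
  have "\<exists>\<psi>\<in>D. capply (cadjoint A) \<psi> = \<phi> \<and> norm \<psi> \<le> (C * norm P) * norm \<phi>" if "\<phi> \<in> D" for \<phi>
  proof -
    define g where "g = inv_into M (capply A)"
    have g: "g y \<in> M" "capply A (g y) = y" if "y \<in> R" for y
      using that unfolding g_def R_def by (auto intro: inv_into_into f_inv_into_f)
    have gA: "g (capply A m) = m" if "m \<in> M" for m
      by (rule uniq[OF g(1) that g(2)]) (use that in \<open>auto simp: R_def\<close>)
    have "norm (g y) \<le> C * norm y" if "y \<in> R" for y
      using C[OF that] g[OF that] uniq by metis
    then have "cmod (capply \<phi> (g y)) \<le> (C * norm \<phi>) * norm y" if "y \<in> R" for y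
      using that order_trans[OF norm_capply mult_left_mono, of "g y" "C * norm y" \<phi>]
      by (simp add: mult_ac)
    moreover have "g (u + v) = g u + g v" if "u \<in> R" "v \<in> R" for u v
      by (rule uniq[OF g(1)[OF csubspaceD(2)[OF Rc that]] csubspaceD(2)[OF Mc g(1)[OF that(1)] g(1)[OF that(2)]]])
        (simp add: capply_linear(1) g(2)[OF csubspaceD(2)[OF Rc that]] g(2)[OF that(1)] g(2)[OF that(2)])
    moreover have "g (c *\<^sub>C u) = c *\<^sub>C g u" if "u \<in> R" for c u
      by (rule uniq[OF g(1)[OF csubspaceD(3)[OF Rc that]] csubspaceD(3)[OF Mc g(1)[OF that]]])
        (simp add: capply_scaleC g(2)[OF csubspaceD(3)[OF Rc that]] g(2)[OF that])
    ultimately obtain \<psi>0 :: "'a cdual" where \<psi>0: "\<And>y. y \<in> R \<Longrightarrow> capply \<psi>0 y = capply \<phi> (g y)"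
        "norm \<psi>0 \<le> C * norm \<phi>"
      using functional_extends[OF Rc, of "C * norm \<phi>" "\<lambda>y. capply \<phi> (g y)"] \<open>C > 0\<close>
      by (simp add: capply_linear(1) capply_scaleC scaleC_complex_def) blast
    show ?thesis
    proof (intro bexI[of _ "\<psi>0 o\<^sub>C\<^sub>L P"] conjI)
      show "\<psi>0 o\<^sub>C\<^sub>L P \<in> D" by (simp add: D_def capply_compose P(4) capply_linear(3))
      show "capply (cadjoint A) (\<psi>0 o\<^sub>C\<^sub>L P) = \<phi>"
      proof (rule cblinfun_eqI)
        fix x
        have "capply \<phi> (x - capply P x) = 0" using P(2) that unfolding D_def by blast
        then show "capply (capply (cadjoint A) (\<psi>0 o\<^sub>C\<^sub>L P)) x = capply \<phi> x"
          using P(1) by (simp add: capply_cadjoint capply_compose PA \<psi>0 R_def gA capply_linear)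
      qed
      have "norm (capply (\<psi>0 o\<^sub>C\<^sub>L P) x) \<le> (norm \<psi>0 * norm P) * norm x" for x
        using order_trans[OF norm_capply mult_left_mono[OF norm_capply[of P x]], of \<psi>0]
        by (simp add: capply_compose mult.assoc)
      then have "norm (\<psi>0 o\<^sub>C\<^sub>L P) \<le> norm \<psi>0 * norm P" by (intro norm_cblinfun_le) auto
      also have "\<dots> \<le> (C * norm \<phi>) * norm P" by (intro mult_right_mono \<psi>0) simp
      finally show "norm (\<psi>0 o\<^sub>C\<^sub>L P) \<le> (C * norm P) * norm \<phi>" by (simp add: mult_ac)
    qed
  qed
  moreover obtain \<theta> :: "'a cdual" where \<theta>: "\<And>v. v \<in> R \<Longrightarrow> capply \<theta> v = 0" "capply \<theta> x = 1"
    using functional_separates[OF clo[folded R_def] Rc] x unfolding R_def by blast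
  have "\<theta> o\<^sub>C\<^sub>L P \<in> D" by (simp add: D_def capply_compose P(4) capply_linear(3))
  moreover have "capply (\<theta> o\<^sub>C\<^sub>L P) x = 1" using x \<theta> P by (simp add: capply_compose)
  then have "\<theta> o\<^sub>C\<^sub>L P \<noteq> 0" using \<theta>(2) by (auto simp: capply_zero)
  moreover have "capply (cadjoint A) (\<theta> o\<^sub>C\<^sub>L P) = 0"
    by (rule cblinfun_eqI)
      (use P(1) \<theta>(1) in \<open>simp add: capply_cadjoint capply_compose PA R_def capply_zero\<close>)
  ultimately have "\<not> SVEP_at (cadjoint T) l"
    by (intro no_SVEP_if_bounded_preimages[of "\<theta> o\<^sub>C\<^sub>L P" D]) (auto simp: shift_cadjoint A_def[symmetric])
  then show False using svep by contradiction
qed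

section \<open>Isolation from a decomposition\<close>

text \<open>If \<open>\<parallel>m\<parallel> \<le> C \<parallel>A m\<parallel>\<close> on \<open>M\<close> and \<open>\<bar>z\<bar> < 1/C\<close>, then \<open>A u - z u = m\<close> says that \<open>u\<close> is a fixed point of the
contraction \<open>u \<mapsto> A\<^sup>-\<^sup>1 (m + z u)\<close> of \<open>M\<close>. On \<open>N\<close> the operator \<open>A - z I\<close> is invertible for every \<open>z \<noteq> 0\<close>.\<close>

lemma isolated_if_decomposition:
  fixes A :: "'a::complex_banach \<Rightarrow>\<^sub>C\<^sub>L 'a"
  assumes M: "closed_csubspace M" and N: "closed_csubspace N"
    and inv: "capply A ` M = M" "capply A ` N \<subseteq> N"
    and sum: "M \<inter> N = {0}" "{x + y |x y. x \<in> M \<and> y \<in> N} = UNIV"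
    and inj: "\<And>x. x \<in> M \<Longrightarrow> capply A x = 0 \<Longrightarrow> x = 0"
    and qn: "quasinilpotent_on N A"
  shows "\<exists>\<epsilon>>0. \<forall>z. z \<noteq> 0 \<and> cmod z < \<epsilon> \<longrightarrow> cinvertible (shift A z)"
proof -
  note M' = M[unfolded closed_csubspace_iff] and N' = N[unfolded closed_csubspace_iff]
  have Ms: "subspace M" and Mc: "csubspace M" and Ns: "subspace N" and Nc: "csubspace N"
    using M' N' csubspace_imp_subspace by blast+
  obtain C where "C > 0" and C: "\<And>y. y \<in> M \<Longrightarrow> \<exists>x\<in>M. capply A x = y \<and> norm x \<le> C * norm y"
    using bounded_preimages[OF bounded_linear_capply _ Ms, of A] M' inv(1) by metis
  obtain h where h: "\<And>y. y \<in> M \<Longrightarrow> h y \<in> M" "\<And>y. y \<in> M \<Longrightarrow> capply A (h y) = y"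
    using C by metis
  have below: "norm x \<le> C * norm (capply A x)" if "x \<in> M" for x
  proof -
    have "capply A x \<in> M" using that inv by blast
    from C[OF this] obtain y where y: "y \<in> M" "capply A y = capply A x" "norm y \<le> C * norm (capply A x)"
      by blast
    then have "y = x" using inj[of "y - x"] that Ms by (simp add: subspace_diff capply_linear)
    then show ?thesis using y by simp
  qed
  have sh: "capply (shift A z) x = capply A x - z *\<^sub>C x" for z x
    by (simp add: capply_minus capply_cblinfun_scaleC capply_id)
  have "cinvertible (shift A z)" if "z \<noteq> 0" "cmod z < 1 / C" for z
  proof (rule cinvertible_if_bij)
    have Cz: "0 \<le> C * cmod z" "C * cmod z < 1" using that \<open>C > 0\<close> by (auto simp: field_simps)
    have stayM: "capply (shift A z) x \<in> M" if "x \<in> M" for x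
      using that inv(1) csubspaceD(3)[OF Mc] Ms by (auto simp: sh intro!: subspace_diff)
    have stayN: "capply (shift A z) x \<in> N" if "x \<in> N" for x
      using that inv(2) csubspaceD(3)[OF Nc] Ns by (auto simp: sh intro!: subspace_diff)
    have "z \<notin> spectrum_on N A" using qn that(1) unfolding quasinilpotent_on_def by blast
    then obtain S K where S: "\<And>x. x \<in> N \<Longrightarrow> S x \<in> N \<and> norm (S x) \<le> K * norm x \<and>
        S (capply (shift A z) x) = x \<and> capply (shift A z) (S x) = x"
      unfolding spectrum_on_def by blast
    have decomp: "\<exists>m n. y = m + n \<and> m \<in> M \<and> n \<in> N" for y
      using sum(2) by blast
    have kerM: "m = 0" if "m \<in> M" "capply (shift A z) m = 0" for m
    proof (rule ccontr)
      assume "m \<noteq> 0"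
      have "norm m \<le> (C * cmod z) * norm m"
        using below[OF that(1)] that(2) by (simp add: sh norm_scaleC mult.assoc)
      then show False using Cz \<open>m \<noteq> 0\<close> by simp
    qed
    have kerN: "n = 0" if "n \<in> N" "capply (shift A z) n = 0" for n
      using S[OF that(1)] S[OF subspace_0[OF Ns]] that(2) by (simp add: capply_linear)
    have "x = 0" if x: "capply (shift A z) x = 0" for x
    proof -
      obtain m n where mn: "x = m + n" "m \<in> M" "n \<in> N" using decomp by blast
      let ?u = "capply (shift A z) m" and ?v = "capply (shift A z) n"
      have "?u = - ?v" using x mn by (simp add: capply_linear(1) eq_neg_iff_add_eq_0)
      then have "?u \<in> N" using stayN[OF mn(3)] subspace_neg[OF Ns] by simp
      then have "?u = 0" using stayM[OF mn(2)] sum(1) by blast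
      then have "?v = 0" using \<open>?u = - ?v\<close> by simp
      show ?thesis using kerM[OF mn(2) \<open>?u = 0\<close>] kerN[OF mn(3) \<open>?v = 0\<close>] mn(1) by simp
    qed
    then have "inj (capply (shift A z))"
      using linear_injective_0 bounded_linear.linear[OF bounded_linear_capply] by blast
    moreover have "\<exists>x. capply (shift A z) x = y" for y
    proof -
      obtain m n where mn: "y = m + n" "m \<in> M" "n \<in> N" using decomp by blast
      have arg: "m + z *\<^sub>C u \<in> M" if "u \<in> M" for u
        using that mn csubspaceD[OF Mc] by auto
      have "\<exists>!u\<in>M. h (m + z *\<^sub>C u) = u"
      proof (rule Banach_fix[of M "C * cmod z"])
        show "complete M" using M' by (simp add: complete_eq_closed)
        show "M \<noteq> {}" using mn by blast
        show "(\<lambda>u. h (m + z *\<^sub>C u)) ` M \<subseteq> M" using h(1) arg by blast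
        fix u v assume uv: "u \<in> M" "v \<in> M"
        have "norm (h (m + z *\<^sub>C u) - h (m + z *\<^sub>C v)) \<le>
            C * norm (capply A (h (m + z *\<^sub>C u) - h (m + z *\<^sub>C v)))"
          using uv h(1) arg Ms by (intro below) (auto intro: subspace_diff)
        also have "\<dots> = C * cmod z * norm (u - v)"
          using uv h(2) arg by (simp add: capply_linear(2) norm_scaleC flip: scaleC_diff_right)
        finally show "dist (h (m + z *\<^sub>C u)) (h (m + z *\<^sub>C v)) \<le> C * cmod z * dist u v"
          by (simp add: dist_norm)
      qed (use Cz in auto)
      then obtain u where u: "u \<in> M" "h (m + z *\<^sub>C u) = u" by blast
      then have "capply A u = m + z *\<^sub>C u" using h(2)[OF arg[OF u(1)]] by simp
      then have "capply (shift A z) u = m" by (simp add: sh)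
      then have "capply (shift A z) (u + S n) = y"
        using S[OF mn(3)] mn(1) by (simp add: capply_linear(1))
      then show ?thesis by blast
    qed
    ultimately show "bij (capply (shift A z))" unfolding bij_def by (metis surj_def)
  qed
  then show ?thesis using \<open>C > 0\<close> by (intro exI[of _ "1 / C"]) auto
qed

lemma generalized_Drazin_invertible_iff:
  "generalized_Drazin_invertible A \<longleftrightarrow>
    (\<exists>\<epsilon>>0. \<forall>z. z \<noteq> 0 \<and> cmod z < \<epsilon> \<longrightarrow> cinvertible (shift A z))"
  unfolding generalized_Drazin_invertible_def islimpt_approachable spectrum_def
  by (auto simp: dist_norm)

lemma cinvertible_injective:
  assumes "cinvertible A" "capply A v = 0"
  shows "v = 0"
proof -
  obtain S where "S o\<^sub>C\<^sub>L A = id_cblinfun" using assms(1) by (auto simp: cinvertible_def)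
  then have "capply S (capply A v) = v" by (simp add: capply_id flip: capply_compose)
  then show ?thesis using assms(2) by (simp add: capply_linear(3))
qed

lemma cinvertible_cadjoint_injective:
  assumes "cinvertible A" "capply (cadjoint A) \<phi> = 0"
  shows "\<phi> = 0"
proof -
  obtain S where "A o\<^sub>C\<^sub>L S = id_cblinfun" using assms(1) by (auto simp: cinvertible_def)
  then have AS: "capply A (capply S x) = x" for x by (simp add: capply_id flip: capply_compose)
  have "capply \<phi> (capply A y) = capply 0 y" for y
    using assms(2) by (simp add: capply_cadjoint flip: capply_compose)
  then have "capply \<phi> x = capply 0 x" for x
    using AS[of x] by (metis capply_zero)
  then show ?thesis by (rule cblinfun_eqI)
qed

lemma generalized_Drazin_invertible_shift_iff:
  fixes T :: "'a::complex_banach \<Rightarrow>\<^sub>C\<^sub>L 'a"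
  shows "generalized_Drazin_invertible (shift T l) \<longleftrightarrow>
    pseudo_Fredholm (shift T l) \<and> SVEP_at T l \<and> SVEP_at (cadjoint T) l" (is "?L \<longleftrightarrow> ?R")
proof
  have sh: "shift (shift T l) (z - l) = shift T z" for z
    by (intro cblinfun_eqI) (simp add: capply_minus capply_cblinfun_scaleC scaleC_diff_left)
  assume ?L
  then obtain \<epsilon> where "\<epsilon> > 0" and \<epsilon>: "\<And>z. z \<noteq> 0 \<Longrightarrow> cmod z < \<epsilon> \<Longrightarrow> cinvertible (shift (shift T l) z)"
    unfolding generalized_Drazin_invertible_iff by blast
  have inv: "cinvertible (shift T z)" if "z \<noteq> l" "dist l z < \<epsilon>" for z
    using \<epsilon>[of "z - l"] that by (simp add: sh dist_norm norm_minus_commute)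
  have "pseudo_Fredholm (shift T l)" using \<open>\<epsilon> > 0\<close> \<epsilon> by (rule pseudo_Fredholm_if_isolated)
  moreover have "SVEP_at T l"
  proof (rule SVEP_if_punctured_injective[OF \<open>\<epsilon> > 0\<close>])
    show "v = 0" if "z \<noteq> l" "dist l z < \<epsilon>" "capply (shift T z) v = 0" for z v
      by (rule cinvertible_injective[OF inv[OF that(1,2)] that(3)])
  qed
  moreover have "SVEP_at (cadjoint T) l"
  proof (rule SVEP_if_punctured_injective[OF \<open>\<epsilon> > 0\<close>])
    show "\<phi> = 0" if "z \<noteq> l" "dist l z < \<epsilon>" "capply (shift (cadjoint T) z) \<phi> = 0" for z \<phi>
      by (rule cinvertible_cadjoint_injective[OF inv[OF that(1,2)] that(3)[unfolded shift_cadjoint]])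
  qed
  ultimately show ?R by blast
next
  assume ?R
  then have svep: "SVEP_at T l" "SVEP_at (cadjoint T) l" by blast+
  from \<open>?R\<close> have "pseudo_Fredholm (shift T l)" by blast
  then obtain M N where MN: "closed_csubspace M" "closed_csubspace N"
    "capply (shift T l) ` M \<subseteq> M" "capply (shift T l) ` N \<subseteq> N"
    "M \<inter> N = {0}" "{x + y |x y. x \<in> M \<and> y \<in> N} = UNIV"
    "semi_regular_on M (shift T l)" "quasinilpotent_on N (shift T l)"
    unfolding pseudo_Fredholm_def by (elim exE conjE) (rule that)
  have inj: "x = 0" if "x \<in> M" "capply (shift T l) x = 0" for x
    using semi_regular_SVEP_injective[OF MN(1,3,7) svep(1) that] .
  have "closed (capply (shift T l) ` M)" using MN(7) unfolding semi_regular_on_def by blast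
  then have "capply (shift T l) ` M = M"
    using adjoint_SVEP_surjective[OF MN(1-6) _ inj svep(2)] by blast
  then show ?L
    unfolding generalized_Drazin_invertible_iff
    using isolated_if_decomposition[OF MN(1,2) _ MN(4-6) inj MN(8)] by blast
qed

theorem theorem2p1:
  fixes T :: "'a::complex_banach \<Rightarrow>\<^sub>C\<^sub>L 'a"
  shows "sigma_gD T = sigma_gK T \<union> (no_SVEP_set T \<union> no_SVEP_set (cadjoint T))"
  unfolding sigma_gD_def sigma_gK_def no_SVEP_set_def generalized_Drazin_invertible_shift_iff
  by blast

end
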